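(* As $n\to\infty$, $$ C_3(n)=\frac{2}{\sqrt{3}\,\pi}\cdot 8^n\cdot n^{-1}\left(1-\frac{13}{3}n^{-1}+\frac{1477}{27}n^{-2}-\frac{93707}{81}n^{-3}+\frac{8343061}{243}n^{-4}-\frac{2866730137}{2187}n^{-5}+\frac{1204239422533}{19683}n^{-6}+O(n^{-7})\right). $$
   Context: For positive integers $m_1,m_2,m_3$, the number $c(m_1,m_2,m_3)$ is defined as the coefficient of $t_1^{m_1-1}t_2^{m_2-1}t_3^{m_3-1}$ in the polynomial $$ \prod_{i=1}^{3}\frac{\hat{t_i}^{\,m_i}-t_i^{m_i}}{\hat{t_i}-t_i},\qquad \hat{t_i}=(t_1+t_2+t_3)-t_i , $$ where each factor is understood as the polynomial $\sum_{k=0}^{m_i-1}\hat{t_i}^{\,k}\,t_i^{\,m_i-1-k}$. For $n\ge 1$, $C_3(n):=c(n,n,n)$. (By a theorem of Friedland and Ottaviani, this is the number of simple singular vector tuples of a generic $n\times n\times n$ tensor; the coefficient is taken as the definition here.) *)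

theory Defs
  imports Complex_Main "HOL-Library.Poly_Mapping" "HOL-Library.Landau_Symbols"
begin

text \<open>
  Polynomials over the integers in indeterminates indexed by natural numbers: a finitely
  supported map from monomials to coefficients, a monomial being a finitely supported map
  from indeterminates to exponents. Multiplication on \<open>poly_mapping\<close> is convolution.
\<close>

type_synonym int_mpoly = "(nat \<Rightarrow>\<^sub>0 nat) \<Rightarrow>\<^sub>0 int"

definition t_var :: "nat \<Rightarrow> int_mpoly" where
  "t_var i = Poly_Mapping.single (Poly_Mapping.single i 1) 1"

definition t_hat :: "nat \<Rightarrow> int_mpoly" where
  "t_hat i = (t_var 1 + t_var 2 + t_var 3) - t_var i"

definition quot_factor :: "nat \<Rightarrow> nat \<Rightarrow> int_mpoly" where
  "quot_factor i m = (\<Sum>k<m. t_hat i ^ k * t_var i ^ (m - 1 - k))"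

lemma quot_factor_mult:
  "quot_factor i m * (t_hat i - t_var i) = t_hat i ^ m - t_var i ^ m"
  unfolding quot_factor_def by (simp add: power_diff_sumr2 mult.commute)

text \<open>Only positive arguments are meaningful, because of the truncated \<open>m - 1\<close>.\<close>

definition c_coeff :: "nat \<Rightarrow> nat \<Rightarrow> nat \<Rightarrow> int" where
  "c_coeff m1 m2 m3 =
     Poly_Mapping.lookup (quot_factor 1 m1 * quot_factor 2 m2 * quot_factor 3 m3)
       (Poly_Mapping.single 1 (m1 - 1) + Poly_Mapping.single 2 (m2 - 1)
          + Poly_Mapping.single 3 (m3 - 1))"

definition C3 :: "nat \<Rightarrow> int" where
  "C3 n = c_coeff n n n"

end

theory Submission
  imports Defs "HOL-Computational_Algebra.Formal_Power_Series" "HOL-Probability.Distributions"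
    "HOL-Real_Asymp.Real_Asymp"
begin

text \<open>
Let \<open>A(i,j,k)\<close> (\<open>hat_coeff\<close>) be the coefficient of \<open>t1^i t2^j t3^k\<close> in
\<open>(t2+t3)^i (t1+t3)^j (t1+t2)^k\<close>. Expanding the three quotients that define \<open>C3 n\<close> shows that
\<open>C3 n\<close> is the sum of \<open>A\<close> over the box \<open>0 \<le> i, j, k < n\<close> (\<open>C3_eq_sum\<close>). The generating function
of \<open>A\<close> is \<open>1 / (1 - xy - xz - yz - 2xyz)\<close> (\<open>hat_fps_inverse\<close>, an instance of MacMahon's master
theorem), so \<open>C3\<close> is the diagonal of a rational function in three variables. The diagonal of
\<open>A\<close> itself consists of the Franel numbers \<open>f(n)\<close>, the sums of the cubes of the binomial
coefficients of order \<open>n\<close>.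

Two recurrences drive the proof. Creative telescoping with an explicit rational certificate gives
\<open>(n+1) C3(n+1) - (10n+5) C3(n) + 9n C3(n-1) = 1 - n (3 f(n-1) + f(n)/2)\<close> (\<open>C3_recurrence\<close>),
and Zeilberger's method gives Franel's own three-term recurrence for \<open>f\<close> (\<open>franel_recurrence\<close>).

A recurrence fixes an asymptotic expansion only up to solutions of its homogeneous part, and the
two recurrences need different arguments to deal with these. For \<open>f\<close> the characteristic roots
are \<open>8\<close> and \<open>-1\<close>, so one constant \<open>L\<close> with \<open>f(n) \<sim> L 8^n / n\<close> has to be found. It is the
Gaussian integral that approximates the sum of cubes on the scale \<open>sqrt n\<close>
(\<open>franel_even_limit\<close>); once it is known, the difference between \<open>n f(n) / 8^n\<close> and a truncated
series tends to \<open>0\<close> and satisfies the same recurrence up to a small residual, which forces the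
difference to be small as well (\<open>null_solution_bigo\<close>). For \<open>C3\<close> the characteristic roots of the
homogeneous part are \<open>9\<close> and \<open>1\<close>. The bound \<open>C3 n \<le> 8^n\<close> excludes a component of growth \<open>9^n\<close>,
and after division by \<open>8^n\<close> the middle coefficient \<open>10\<close> dominates the outer ones \<open>8\<close> and \<open>9/8\<close>, so a
maximum principle bounds every bounded solution by the residual (\<open>bounded_solution_bigo\<close>).

In both cases the residual of the truncated series is an explicit rational function of \<open>n\<close>, and the
coefficients in the theorem are exactly those for which it decays fast enough.
\<close>

section \<open>The defining coefficient as a sum over a box\<close>

lemma lookup_single_mult_add:
  fixes p :: "('a::cancel_comm_monoid_add) \<Rightarrow>\<^sub>0 ('b::semiring_1)"
  shows "Poly_Mapping.lookup (Poly_Mapping.single m 1 * p) (m + k) = Poly_Mapping.lookup p k"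
proof -
  have "Poly_Mapping.lookup (Poly_Mapping.single m 1 * p) (m + k)
      = (\<Sum>l. (\<Sum>q. Poly_Mapping.lookup p q when m + k = l + q) when l = m)"
    unfolding lookup_mult by (rule Sum_any.cong) (auto simp: lookup_single when_def)
  also have "\<dots> = Poly_Mapping.lookup p k"
    by (simp add: eq_commute[of k])
  finally show ?thesis .
qed

lemma lookup_single_mult_eq_0:
  fixes p :: "('a::cancel_comm_monoid_add) \<Rightarrow>\<^sub>0 ('b::semiring_1)"
  assumes "\<And>k'. k \<noteq> m + k'"
  shows "Poly_Mapping.lookup (Poly_Mapping.single m 1 * p) k = 0"
proof -
  have "Poly_Mapping.lookup (Poly_Mapping.single m 1 * p) k
      = (\<Sum>l. (\<Sum>q. Poly_Mapping.lookup p q when k = l + q) when l = m)"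
    unfolding lookup_mult by (rule Sum_any.cong) (auto simp: lookup_single when_def)
  also have "\<dots> = 0"
    using assms by simp
  finally show ?thesis .
qed

definition mono3 :: "nat \<Rightarrow> nat \<Rightarrow> nat \<Rightarrow> (nat \<Rightarrow>\<^sub>0 nat)" where
  "mono3 i j k = Poly_Mapping.single 1 i + Poly_Mapping.single 2 j + Poly_Mapping.single 3 k"

lemma mono3_add: "mono3 i j k + mono3 i' j' k' = mono3 (i + i') (j + j') (k + k')"
  by (simp add: mono3_def single_add algebra_simps)

lemma lookup_mono3 [simp]:
  "Poly_Mapping.lookup (mono3 i j k) 1 = i"
  "Poly_Mapping.lookup (mono3 i j k) (Suc 0) = i"
  "Poly_Mapping.lookup (mono3 i j k) 2 = j"
  "Poly_Mapping.lookup (mono3 i j k) 3 = k"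
  by (simp_all add: mono3_def lookup_add lookup_single)

lemma t_var_power: "t_var i ^ k = Poly_Mapping.single (Poly_Mapping.single i k) 1"
  by (induction k) (auto simp: t_var_def mult_single single_add[symmetric])

lemma t_monomial: "t_var 1 ^ i * t_var 2 ^ j * t_var 3 ^ k = Poly_Mapping.single (mono3 i j k) 1"
  by (simp add: t_var_power mult_single mono3_def)

definition coeff3 :: "int_mpoly \<Rightarrow> nat \<Rightarrow> nat \<Rightarrow> nat \<Rightarrow> int" where
  "coeff3 p i j k = Poly_Mapping.lookup p (mono3 i j k)"

lemma coeff3_add [simp]: "coeff3 (p + q) i j k = coeff3 p i j k + coeff3 q i j k"
  by (simp add: coeff3_def lookup_add)

text \<open>
All coefficients below are computed by pulling monomials out of a product with this rule.
\<close>

lemma coeff3_monomial_mult: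
  "coeff3 (t_var 1 ^ a * t_var 2 ^ b * t_var 3 ^ c * p) i j k =
     (if a \<le> i \<and> b \<le> j \<and> c \<le> k then coeff3 p (i - a) (j - b) (k - c) else 0)"
proof (cases "a \<le> i \<and> b \<le> j \<and> c \<le> k")
  case True
  then have "mono3 i j k = mono3 a b c + mono3 (i - a) (j - b) (k - c)"
    by (simp add: mono3_add)
  then show ?thesis
    using True by (simp only: coeff3_def t_monomial lookup_single_mult_add if_True simp_thms)
next
  case False
  have ne: "mono3 i j k \<noteq> mono3 a b c + k'" for k'
  proof
    assume "mono3 i j k = mono3 a b c + k'"
    then have "Poly_Mapping.lookup (mono3 i j k) l = Poly_Mapping.lookup (mono3 a b c) l + Poly_Mapping.lookup k' l" for l
      by (simp add: lookup_add)
    from this[of 1] this[of 2] this[of 3] False show False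
      by simp
  qed
  then show ?thesis
    unfolding coeff3_def t_monomial lookup_single_mult_eq_0[OF ne] using False by auto
qed

definition hat_prod :: "nat \<Rightarrow> nat \<Rightarrow> nat \<Rightarrow> int_mpoly" where
  "hat_prod i j k = t_hat 1 ^ i * t_hat 2 ^ j * t_hat 3 ^ k"

definition hat_coeff :: "nat \<Rightarrow> nat \<Rightarrow> nat \<Rightarrow> int" where
  "hat_coeff i j k = coeff3 (hat_prod i j k) i j k"

lemma sum_product3:
  fixes f g h :: "nat \<Rightarrow> 'a::comm_semiring_1"
  shows "sum f A * sum g B * sum h C = (\<Sum>i\<in>A. \<Sum>j\<in>B. \<Sum>k\<in>C. f i * g j * h k)"
proof -
  have "sum f A * sum g B * sum h C = (\<Sum>i\<in>A. f i * (sum g B * sum h C))"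
    by (simp add: sum_distrib_right mult.assoc)
  then show ?thesis
    by (simp add: sum_product) (simp add: sum_distrib_left mult.assoc)
qed

text \<open>
The summand of the product of the three quotients with indices \<open>i, j, k\<close> contains the monomial
\<open>t1^(n-1-i) t2^(n-1-j) t3^(n-1-k)\<close>, which lowers the exponents \<open>n-1\<close> of the wanted coefficient to
\<open>i, j, k\<close>.
\<close>

lemma C3_eq_sum: "C3 n = (\<Sum>i<n. \<Sum>j<n. \<Sum>k<n. hat_coeff i j k)"
proof -
  have "quot_factor 1 n * quot_factor 2 n * quot_factor 3 n =
     (\<Sum>i<n. \<Sum>j<n. \<Sum>k<n. t_var 1 ^ (n - 1 - i) * t_var 2 ^ (n - 1 - j) * t_var 3 ^ (n - 1 - k) * hat_prod i j k)"
    unfolding quot_factor_def hat_prod_def sum_product3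
    by (intro sum.cong refl) (simp only: mult_ac)
  then have "C3 n = (\<Sum>i<n. \<Sum>j<n. \<Sum>k<n. coeff3 (t_var 1 ^ (n - 1 - i) * t_var 2 ^ (n - 1 - j) * t_var 3 ^ (n - 1 - k) * hat_prod i j k) (n - 1) (n - 1) (n - 1))"
    by (simp add: C3_def c_coeff_def coeff3_def mono3_def lookup_sum)
  also have "\<dots> = (\<Sum>i<n. \<Sum>j<n. \<Sum>k<n. hat_coeff i j k)"
    unfolding coeff3_monomial_mult by (intro sum.cong refl) (auto simp: hat_coeff_def)
  finally show ?thesis .
qed

lemma coeff3_t_mult:
  "coeff3 (t_var 1 * p) i j k = (if 0 < i then coeff3 p (i - 1) j k else 0)"
  "coeff3 (t_var 2 * p) i j k = (if 0 < j then coeff3 p i (j - 1) k else 0)"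
  "coeff3 (t_var 3 * p) i j k = (if 0 < k then coeff3 p i j (k - 1) else 0)"
  using coeff3_monomial_mult[of 1 0 0 p i j k] coeff3_monomial_mult[of 0 1 0 p i j k]
    coeff3_monomial_mult[of 0 0 1 p i j k] by (auto simp: Suc_le_eq)

lemma hat_expand: "t_hat 1 = t_var 2 + t_var 3" "t_hat 2 = t_var 1 + t_var 3" "t_hat 3 = t_var 1 + t_var 2"
  by (simp_all add: t_hat_def)

text \<open>
This says that the generating function of \<open>hat_coeff\<close> is inverse to \<open>1 - xy - xz - yz - 2xyz\<close>. With
\<open>h1 = t2 + t3\<close>, \<open>h2 = t1 + t3\<close>, \<open>h3 = t1 + t2\<close> it rests on the identity
\<open>h1 h2 h3 = t1 t2 h3 + t1 t3 h2 + t2 t3 h1 + 2 t1 t2 t3\<close>, where in each term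
on the right the \<open>ti\<close> split off have the same indices as the \<open>hi\<close> used up. If \<open>k = 0\<close>, the identity
\<open>h1 h2 = t1 t2 + t3 (t1 + t2 + t3)\<close> takes its place, because a multiple of \<open>t3\<close> has no monomial
free of \<open>t3\<close>.
\<close>

lemma hat_coeff_rec:
  "hat_coeff i j k = (if i = 0 \<and> j = 0 \<and> k = 0 then 1 else 0)
     + (if 0 < i \<and> 0 < j then hat_coeff (i - 1) (j - 1) k else 0)
     + (if 0 < i \<and> 0 < k then hat_coeff (i - 1) j (k - 1) else 0)
     + (if 0 < j \<and> 0 < k then hat_coeff i (j - 1) (k - 1) else 0)
     + (if 0 < i \<and> 0 < j \<and> 0 < k then 2 * hat_coeff (i - 1) (j - 1) (k - 1) else 0)"
proof -
  let ?x = "t_var 1" and ?y = "t_var 2" and ?z = "t_var 3"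
  have one: "coeff3 1 0 0 0 = 1"
    by (simp add: coeff3_def mono3_def)
  consider (000) "i = 0" "j = 0" "k = 0" | (111) a b c where "i = Suc a" "j = Suc b" "k = Suc c"
    | (110) a b where "i = Suc a" "j = Suc b" "k = 0"
    | (101) a b where "i = Suc a" "j = 0" "k = Suc b"
    | (011) a b where "i = 0" "j = Suc a" "k = Suc b"
    | (100) a where "i = Suc a" "j = 0" "k = 0"
    | (010) a where "i = 0" "j = Suc a" "k = 0"
    | (001) a where "i = 0" "j = 0" "k = Suc a"
    by (metis not0_implies_Suc)
  then show ?thesis
  proof cases
    case 000
    then show ?thesis by (simp add: hat_coeff_def hat_prod_def one)
  next
    case (111 a b c)
    have "hat_prod i j k = ?x * (?y * (t_hat 3 * hat_prod a b c)) + ?x * (?z * (t_hat 2 * hat_prod a b c))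
         + ?y * (?z * (t_hat 1 * hat_prod a b c)) + ?x * (?y * (?z * hat_prod a b c)) + ?x * (?y * (?z * hat_prod a b c))"
      unfolding 111 hat_prod_def power_Suc hat_expand by (simp add: algebra_simps)
    moreover have "t_hat 3 * hat_prod a b c = hat_prod a b k" "t_hat 2 * hat_prod a b c = hat_prod a j c"
      "t_hat 1 * hat_prod a b c = hat_prod i b c"
      unfolding 111 hat_prod_def power_Suc by (simp_all add: mult_ac)
    ultimately have "coeff3 (hat_prod i j k) i j k = coeff3 (hat_prod a b k) a b k + coeff3 (hat_prod a j c) a j c
        + coeff3 (hat_prod i b c) i b c + coeff3 (hat_prod a b c) a b c + coeff3 (hat_prod a b c) a b c"
      using 111 by (simp only: coeff3_add coeff3_t_mult) simp
    then show ?thesis using 111 by (simp add: hat_coeff_def)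
  next
    case (110 a b)
    have "hat_prod i j k = ?x * (?y * hat_prod a b 0) + ?z * ((?x + ?y + ?z) * hat_prod a b 0)"
      unfolding 110 hat_prod_def power_Suc hat_expand by (simp add: algebra_simps)
    then have "coeff3 (hat_prod i j k) i j k = coeff3 (hat_prod a b 0) a b 0"
      using 110 by (simp only: coeff3_add coeff3_t_mult) simp
    then show ?thesis using 110 by (simp add: hat_coeff_def)
  next
    case (101 a b)
    have "hat_prod i j k = ?x * (?z * hat_prod a 0 b) + ?y * ((?x + ?y + ?z) * hat_prod a 0 b)"
      unfolding 101 hat_prod_def power_Suc hat_expand by (simp add: algebra_simps)
    then have "coeff3 (hat_prod i j k) i j k = coeff3 (hat_prod a 0 b) a 0 b"
      using 101 by (simp only: coeff3_add coeff3_t_mult) simp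
    then show ?thesis using 101 by (simp add: hat_coeff_def)
  next
    case (011 a b)
    have "hat_prod i j k = ?y * (?z * hat_prod 0 a b) + ?x * ((?x + ?y + ?z) * hat_prod 0 a b)"
      unfolding 011 hat_prod_def power_Suc hat_expand by (simp add: algebra_simps)
    then have "coeff3 (hat_prod i j k) i j k = coeff3 (hat_prod 0 a b) 0 a b"
      using 011 by (simp only: coeff3_add coeff3_t_mult) simp
    then show ?thesis using 011 by (simp add: hat_coeff_def)
  next
    case (100 a)
    have "hat_prod i j k = ?y * hat_prod a 0 0 + ?z * hat_prod a 0 0"
      unfolding 100 hat_prod_def power_Suc hat_expand by (simp add: algebra_simps)
    then show ?thesis using 100 by (simp only: hat_coeff_def coeff3_add coeff3_t_mult) simp
  next
    case (010 a)
    have "hat_prod i j k = ?x * hat_prod 0 a 0 + ?z * hat_prod 0 a 0"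
      unfolding 010 hat_prod_def power_Suc hat_expand by (simp add: algebra_simps)
    then show ?thesis using 010 by (simp only: hat_coeff_def coeff3_add coeff3_t_mult) simp
  next
    case (001 a)
    have "hat_prod i j k = ?x * hat_prod 0 0 a + ?y * hat_prod 0 0 a"
      unfolding 001 hat_prod_def power_Suc hat_expand by (simp add: algebra_simps)
    then show ?thesis using 001 by (simp only: hat_coeff_def coeff3_add coeff3_t_mult) simp
  qed
qed

text \<open>
For positive \<open>i, j, k\<close> the upper bound solves the recurrence, as the denominator
\<open>1 - xy - xz - yz - 2xyz\<close> vanishes at \<open>x = y = z = 1/2\<close>; if an index is \<open>0\<close>, terms are missing on the
right, and it is a supersolution.
\<close>

lemma hat_coeff_bounds: "0 \<le> hat_coeff i j k \<and> hat_coeff i j k \<le> 2 ^ (i + j + k)"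
proof (induction "i + j + k" arbitrary: i j k rule: less_induct)
  case less
  have 1: "0 \<le> hat_coeff (i - 1) (j - 1) k \<and> 4 * hat_coeff (i - 1) (j - 1) k \<le> 2 ^ (i + j + k)" if "0 < i" "0 < j"
  proof -
    have "(2::int) ^ (i + j + k) = 4 * 2 ^ (i - 1 + (j - 1) + k)"
      using that by (cases i; cases j) auto
    then show ?thesis using less[of "i - 1" "j - 1" k] that by simp
  qed
  have 2: "0 \<le> hat_coeff (i - 1) j (k - 1) \<and> 4 * hat_coeff (i - 1) j (k - 1) \<le> 2 ^ (i + j + k)" if "0 < i" "0 < k"
  proof -
    have "(2::int) ^ (i + j + k) = 4 * 2 ^ (i - 1 + j + (k - 1))"
      using that by (cases i; cases k) auto
    then show ?thesis using less[of "i - 1" j "k - 1"] that by simp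
  qed
  have 3: "0 \<le> hat_coeff i (j - 1) (k - 1) \<and> 4 * hat_coeff i (j - 1) (k - 1) \<le> 2 ^ (i + j + k)" if "0 < j" "0 < k"
  proof -
    have "(2::int) ^ (i + j + k) = 4 * 2 ^ (i + (j - 1) + (k - 1))"
      using that by (cases j; cases k) auto
    then show ?thesis using less[of i "j - 1" "k - 1"] that by simp
  qed
  have 4: "0 \<le> hat_coeff (i - 1) (j - 1) (k - 1) \<and> 8 * hat_coeff (i - 1) (j - 1) (k - 1) \<le> 2 ^ (i + j + k)"
    if "0 < i" "0 < j" "0 < k"
  proof -
    have "(2::int) ^ (i + j + k) = 8 * 2 ^ (i - 1 + (j - 1) + (k - 1))"
      using that by (cases i; cases j; cases k) auto
    then show ?thesis using less[of "i - 1" "j - 1" "k - 1"] that by simp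
  qed
  show ?case
    using 1 2 3 4 one_le_power[of "2::int" "i + j + k"]
    by (subst (1 2) hat_coeff_rec) (auto split: if_splits)
qed

text \<open>
The exponential rate \<open>8\<close> is sharp. It lies below the rate \<open>9\<close> of the dominant solution of the homogeneous
recurrence that appears later, and this is what selects the right solution there.
\<close>

lemma C3_bounds: "0 \<le> C3 n" "C3 n \<le> 8 ^ n"
proof -
  show "0 \<le> C3 n"
    unfolding C3_eq_sum by (intro sum_nonneg) (use hat_coeff_bounds in blast)
  have geo: "(\<Sum>i<n. (2::int) ^ i) \<le> 2 ^ n"
    using mask_eq_sum_exp[of n, where ?'a=int] by (simp add: lessThan_def mask_eq_exp_minus_1)
  have "C3 n \<le> (\<Sum>i<n. \<Sum>j<n. \<Sum>k<n. 2 ^ (i + j + k))"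
    unfolding C3_eq_sum by (intro sum_mono) (use hat_coeff_bounds in blast)
  also have "\<dots> = (\<Sum>i<n. 2 ^ i) * ((\<Sum>i<n. 2 ^ i) * (\<Sum>i<n. 2 ^ i))"
    by (simp add: power_add sum_distrib_left sum_distrib_right mult_ac)
  also have "\<dots> \<le> 2 ^ n * (2 ^ n * 2 ^ n)"
    by (intro mult_mono geo mult_nonneg_nonneg sum_nonneg) auto
  also have "\<dots> = 8 ^ n"
    by (simp add: power_mult_distrib[symmetric])
  finally show "C3 n \<le> 8 ^ n" .
qed

section \<open>Derivations of iterated power series rings\<close>

unbundle no vec_syntax
unbundle fps_syntax

text \<open>
In a ring of power series in \<open>x, y, z\<close> the operators \<open>x d/dx\<close>, \<open>y d/dy\<close> and \<open>z d/dz\<close> multiply a coefficient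
by its exponent. On the diagonal all three therefore act as multiplication by \<open>n\<close>, so that an
identity between rational functions and such derivatives becomes a recurrence in \<open>n\<close>.
\<close>

definition derivation :: "('a::comm_ring_1 \<Rightarrow> 'a) \<Rightarrow> bool" where
  "derivation d \<longleftrightarrow> (\<forall>a b. d (a + b) = d a + d b) \<and> (\<forall>a b. d (a * b) = d a * b + a * d b)"

lemma
  assumes "derivation d"
  shows derivation_add: "d (a + b) = d a + d b"
    and derivation_mult: "d (a * b) = d a * b + a * d b"
    and derivation_0: "d 0 = 0"
    and derivation_1: "d 1 = 0"
    and derivation_diff: "d (a - b) = d a - d b"
    and derivation_numeral: "d (numeral w) = 0"
proof -
  show add: "d (a + b) = d a + d b" for a b
    using assms by (simp add: derivation_def)
  show mult: "d (a * b) = d a * b + a * d b" for a b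
    using assms by (simp add: derivation_def)
  show 0: "d 0 = 0"
    using add[of 0 0] by simp
  show 1: "d 1 = 0"
    using mult[of 1 1] by simp
  have minus: "d (- a) = - d a" for a
    using add[of a "- a"] 0 by (simp add: add_eq_0_iff2)
  show "d (a - b) = d a - d b"
    using add[of a "- b"] minus[of b] by simp
  have of_nat: "d (of_nat n) = 0" for n
    by (induction n) (simp_all add: 0 1 add)
  show "d (numeral w) = 0"
    using of_nat[of "numeral w"] by simp
qed

definition theta :: "'a::comm_ring_1 fps \<Rightarrow> 'a fps" where
  "theta F = fps_X * fps_deriv F"

text \<open>
Trivariate series are iterated univariate ones, so the derivation of an inner variable is the
coefficientwise extension of a derivation of the coefficient ring.
\<close>

definition fps_map :: "('a \<Rightarrow> 'a) \<Rightarrow> 'a fps \<Rightarrow> 'a fps" where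
  "fps_map d F = Abs_fps (\<lambda>n. d (F $ n))"

lemma theta_nth [simp]: "theta F $ n = of_nat n * F $ n"
  by (cases n) (simp_all add: theta_def)

lemma fps_map_nth [simp]: "fps_map d F $ n = d (F $ n)"
  by (simp add: fps_map_def)

lemma derivation_theta: "derivation theta"
  by (simp add: derivation_def theta_def algebra_simps)

lemma derivation_sum:
  assumes "derivation d"
  shows "d (sum f A) = (\<Sum>a\<in>A. d (f a))"
  by (induction A rule: infinite_finite_induct) (simp_all add: assms derivation_0 derivation_add)

lemma derivation_fps_map:
  assumes "derivation d"
  shows "derivation (fps_map d)"
  unfolding derivation_def
  by (auto simp: fps_eq_iff fps_mult_nth derivation_sum derivation_add derivation_mult assms sum.distrib)

lemma fps_map_const: "d 0 = 0 \<Longrightarrow> fps_map d (fps_const c) = fps_const (d c)"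
  by (simp add: fps_eq_iff)

lemma fps_map_X: "d 0 = 0 \<Longrightarrow> d 1 = 0 \<Longrightarrow> fps_map d fps_X = 0"
  by (simp add: fps_eq_iff fps_X_def)

lemma theta_const [simp]: "theta (fps_const c) = 0"
  by (simp add: theta_def)

lemma theta_X [simp]: "theta fps_X = fps_X"
  by (simp add: theta_def)

lemma derivation_inverse:
  assumes "derivation d" "a * u = 1"
  shows "d u = - (u * u * d a)"
proof -
  \<comment> \<open>Differentiating \<open>a * u = 1\<close> gives \<open>d a * u + a * d u = 0\<close>.\<close>
  have "u * d (a * u) = 0"
    by (simp add: assms derivation_1)
  then have "u * u * d a + (a * u) * d u = 0"
    by (simp only: derivation_mult[OF assms(1)]) (simp add: algebra_simps)
  then show ?thesis
    using assms(2) by (simp add: add_eq_0_iff2)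
qed

section \<open>The telescoping certificate\<close>

text \<open>
The denominator of the generating function of \<open>hat_coeff\<close>.
\<close>

definition box_denom :: "'a::comm_ring_1 \<Rightarrow> 'a \<Rightarrow> 'a \<Rightarrow> 'a" where
  "box_denom x y z = 1 - x * y - x * z - y * z - 2 * (x * y * z)"

text \<open>
A certificate found by linear algebra. With \<open>N = 1 / ((1-x)(1-y)(1-z))\<close>, \<open>u = 1 / D\<close>, \<open>D = box_denom x y z\<close>
and \<open>p = xyz\<close>, the three series \<open>Gx = (1-x) * cert_num x y z * N * u\<close>, \<open>Gy\<close> and \<open>Gz\<close> (with the roles of
the variables exchanged; the polynomial is symmetric in its last two arguments) satisfy
\<open>Gx + Gy + Gz = 2 (1 - 10 p + 9 p^2) N u + (6 p + 1) u\<close> and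
\<open>x dGx/dx + y dGy/dy + z dGz/dz = 2 N - 2 (1 - 5 p) N u\<close>. The diagonal of the second series is \<open>n\<close> times that
of the first, and this is the recurrence for \<open>C3\<close>. The factor \<open>1-x\<close> of \<open>Gx\<close> cancels the pole of \<open>N\<close> at
\<open>x = 1\<close>, which the derivative would otherwise double.
\<close>

definition cert_num :: "'a::comm_ring_1 \<Rightarrow> 'a \<Rightarrow> 'a \<Rightarrow> 'a" where
  "cert_num x y z = 1 + 5 * (y * z) - y * z * (y + z) - 2 * (y * z) * (y * z)
     - x * (2 * (y + z) + (y * y + z * z) + 4 * (y * z) * (y + z) + 4 * (y * z) * (y * z))"

text \<open>
The identity for \<open>Gx + Gy + Gz\<close> after division by \<open>N * u\<close>.
\<close>

lemma cert_num_sum: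
  fixes x y z :: "'a::idom"
  shows "(1 - x) * cert_num x y z + (1 - y) * cert_num y x z + (1 - z) * cert_num z x y
     = 2 * (1 - 10 * (x * y * z) + 9 * (x * y * z) * (x * y * z)) + (6 * (x * y * z) + 1) * ((1 - x) * (1 - y) * (1 - z))"
  unfolding cert_num_def by algebra

text \<open>
The identity for the sum of the derivatives after multiplication by \<open>D^2 / N\<close>; \<open>g x y z\<close> is the numerator
of the derivative of \<open>cert_num x y z / D\<close>. Since \<open>cert_num\<close> has degree one in its first argument,
\<open>x d/dx\<close> takes it to \<open>cert_num x y z - cert_num 0 y z\<close>.
\<close>

lemma cert_divergence_poly:
  fixes x y z :: "'a::idom"
  defines "D \<equiv> box_denom x y z"
  defines "g \<equiv> \<lambda>x y z. (cert_num x y z - cert_num 0 y z) * D + cert_num x y z * (x * (y + z + 2 * (y * z)))"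
  shows "(1 - x) * g x y z + (1 - y) * g y x z + (1 - z) * g z x y
     = 2 * D * D - 2 * (1 - 5 * (x * y * z)) * D"
  unfolding g_def D_def cert_num_def box_denom_def by algebra

lemma cert_theta:
  fixes x y z :: "'a::comm_ring_1"
  assumes d: "derivation d" and xyz: "d x = x" "d y = 0" "d z = 0"
    and u: "box_denom x y z * u = 1"
    and b: "(1 - y) * b = 1" and c: "(1 - z) * c = 1" and a: "(1 - x) * a = 1"
  shows "d (cert_num x y z * b * c * u) = (1 - x) * ((cert_num x y z - cert_num 0 y z) * box_denom x y z
       + cert_num x y z * (x * (y + z + 2 * (y * z)))) * (a * b * c * u * u)"
proof -
  note rules = derivation_add[OF d] derivation_mult[OF d] derivation_diff[OF d] derivation_1[OF d] derivation_0[OF d]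
    derivation_numeral[OF d] xyz
  have db: "d b = 0"
    using derivation_inverse[OF d b] by (simp add: rules)
  have dc: "d c = 0"
    using derivation_inverse[OF d c] by (simp add: rules)
  have dD: "d (box_denom x y z) = - (x * (y + z + 2 * (y * z)))"
    unfolding box_denom_def by (simp add: rules algebra_simps)
  have dP: "d (cert_num x y z) = cert_num x y z - cert_num 0 y z"
    unfolding cert_num_def by (simp add: rules)
  have du: "d u = u * u * (x * (y + z + 2 * (y * z)))"
    using derivation_inverse[OF d u] by (simp add: dD)
  have "d (cert_num x y z * b * c * u) = (cert_num x y z - cert_num 0 y z) * b * c * u + cert_num x y z * b * c * (u * u * (x * (y + z + 2 * (y * z))))"
    by (simp add: rules db dc dP du)
  also have "\<dots> = (cert_num x y z - cert_num 0 y z) * b * c * u * ((1 - x) * a) * (box_denom x y z * u)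
      + cert_num x y z * b * c * (u * u * (x * (y + z + 2 * (y * z)))) * ((1 - x) * a)"
    by (simp add: a u)
  finally show ?thesis
    by (simp add: algebra_simps)
qed

section \<open>The recurrence between box sums and diagonal coefficients\<close>

lemma geometric_fps: "(1 - fps_X) * Abs_fps (\<lambda>_. 1) = (1 :: 'a::comm_ring_1 fps)"
  by (auto simp: fps_eq_iff left_diff_distrib)

lemma geometric_fps_mult_nth: "(Abs_fps (\<lambda>_. 1) * F) $ n = (\<Sum>i\<le>n. (F :: 'a::comm_ring_1 fps) $ i)"
  by (simp add: fps_mult_nth atMost_atLeast0 sum.nat_diff_reindex[symmetric] sum.atLeastAtMost_rev[of "\<lambda>i. F $ i" 0])

type_synonym fps3 = "int fps fps fps"

abbreviation XX :: fps3 where "XX \<equiv> fps_X"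
abbreviation YY :: fps3 where "YY \<equiv> fps_const fps_X"
abbreviation ZZ :: fps3 where "ZZ \<equiv> fps_const (fps_const fps_X)"

abbreviation GX :: fps3 where "GX \<equiv> Abs_fps (\<lambda>_. 1)"
abbreviation GY :: fps3 where "GY \<equiv> fps_const (Abs_fps (\<lambda>_. 1))"
abbreviation GZ :: fps3 where "GZ \<equiv> fps_const (fps_const (Abs_fps (\<lambda>_. 1)))"

definition diag :: "fps3 \<Rightarrow> nat \<Rightarrow> int" where
  "diag F n = F $ n $ n $ n"

lemma diag_simps [simp]:
  "diag (F + G) n = diag F n + diag G n"
  "diag (F - G) n = diag F n - diag G n"
  "diag (numeral w * F) n = numeral w * diag F n"
  by (simp_all add: diag_def numeral_fps_const)

lemma diag_shift: "diag (XX * YY * ZZ * F) n = (if n = 0 then 0 else diag F (n - 1))"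
  by (simp add: diag_def mult.assoc)

lemma diag_theta:
  "diag (theta F) n = int n * diag F n"
  "diag (fps_map theta F) n = int n * diag F n"
  "diag (fps_map (fps_map theta) F) n = int n * diag F n"
  by (simp_all add: diag_def fps_of_nat[symmetric])

definition hat_fps :: fps3 where
  "hat_fps = Abs_fps (\<lambda>i. Abs_fps (\<lambda>j. Abs_fps (\<lambda>k. hat_coeff i j k)))"

lemma hat_fps_inverse: "box_denom XX YY ZZ * hat_fps = 1"
proof -
  have "hat_fps = 1 + XX * (YY * hat_fps) + XX * (ZZ * hat_fps) + YY * (ZZ * hat_fps)
      + 2 * (XX * (YY * (ZZ * hat_fps)))"
    unfolding fps_eq_iff
  proof (intro allI)
    fix i j k
    show "hat_fps $ i $ j $ k = (1 + XX * (YY * hat_fps) + XX * (ZZ * hat_fps) + YY * (ZZ * hat_fps)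
      + 2 * (XX * (YY * (ZZ * hat_fps)))) $ i $ j $ k"
      using hat_coeff_rec[of i j k] by (simp add: hat_fps_def numeral_fps_const)
  qed
  then show ?thesis
    by (simp add: box_denom_def algebra_simps)
qed

lemma diag_hat_fps: "diag hat_fps n = hat_coeff n n n"
  by (simp add: diag_def hat_fps_def)

lemma diag_sum_hat_fps: "diag (GX * GY * GZ * hat_fps) n = C3 (Suc n)"
  by (simp add: diag_def mult.assoc geometric_fps_mult_nth fps_sum_nth hat_fps_def C3_eq_sum lessThan_Suc_atMost)

lemma diag_geometric: "diag (GX * GY * GZ) n = 1"
  by (simp add: diag_def mult.assoc mult.commute[of GX])

text \<open>
The coefficients of \<open>(xyz)^n\<close> on the two sides of the certificate identities. Here
\<open>diag (N * u) n = C3 (n + 1)\<close>, because multiplication by \<open>N\<close> sums the coefficients of \<open>u\<close> over a box, and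
multiplication by \<open>xyz\<close> shifts the diagonal by one.
\<close>

lemma C3_recurrence_int:
  "int n * (2 * C3 (Suc n) - 20 * C3 n + 18 * (if n = 0 then 0 else C3 (n - 1))
      + (if n = 0 then 0 else 6 * hat_coeff (n - 1) (n - 1) (n - 1)) + hat_coeff n n n)
     = 2 - 2 * C3 (Suc n) + 10 * C3 n"
proof -
  define a b c u where defs: "a = GX" "b = GY" "c = GZ" "u = hat_fps"
  define x y z where xyz: "x = XX" "y = YY" "z = ZZ"
  have u: "box_denom x y z * u = 1"
    unfolding defs xyz by (rule hat_fps_inverse)
  have a: "(1 - x) * a = 1"
    unfolding defs xyz by (rule geometric_fps)
  have b: "(1 - y) * b = 1"
    unfolding defs xyz using geometric_fps[where ?'a = "int fps"]
    by (simp only: fps_const_1_eq_1[symmetric] fps_const_sub fps_const_mult)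
  have c: "(1 - z) * c = 1"
    unfolding defs xyz using geometric_fps[where ?'a = "int"]
    by (simp only: fps_const_1_eq_1[symmetric] fps_const_sub fps_const_mult)
  define Gx Gy Gz where G: "Gx = cert_num x y z * b * c * u" "Gy = cert_num y x z * a * c * u" "Gz = cert_num z x y * a * b * u"
  have sum: "Gx + Gy + Gz = 2 * (a * b * c * u) - 20 * (x * y * z * (a * b * c * u)) + 18 * (x * y * z * (x * y * z * (a * b * c * u)))
      + 6 * (x * y * z * u) + u"
  proof -
    have "Gx + Gy + Gz = cert_num x y z * ((1 - x) * a) * b * c * u + cert_num y x z * a * ((1 - y) * b) * c * u + cert_num z x y * a * b * ((1 - z) * c) * u"
      by (simp add: a b c G)
    also have "\<dots> = ((1 - x) * cert_num x y z + (1 - y) * cert_num y x z + (1 - z) * cert_num z x y) * (a * b * c * u)"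
      by (simp add: algebra_simps)
    also have "\<dots> = 2 * (1 - 10 * (x * y * z) + 9 * (x * y * z) * (x * y * z)) * (a * b * c * u) + (6 * (x * y * z) + 1) * ((1 - x) * a) * ((1 - y) * b) * ((1 - z) * c) * u"
      unfolding cert_num_sum by (simp only: distrib_right distrib_left mult_ac)
    finally show ?thesis
      unfolding a b c by (simp add: algebra_simps)
  qed
  have div: "theta Gx + fps_map theta Gy + fps_map (fps_map theta) Gz = 2 * (a * b * c) - 2 * (a * b * c * u) + 10 * (x * y * z * (a * b * c * u))"
  proof -
    note dv = derivation_theta derivation_fps_map[OF derivation_theta] derivation_fps_map[OF derivation_fps_map[OF derivation_theta]]
    have sym: "box_denom y x z = box_denom x y z" "box_denom z x y = box_denom x y z"
      by (simp_all add: box_denom_def algebra_simps)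
    define g where "g = (\<lambda>v v' v''. (cert_num v v' v'' - cert_num 0 v' v'') * box_denom x y z + cert_num v v' v'' * (v * (v' + v'' + 2 * (v' * v''))))"
    have 1: "theta Gx = (1 - x) * g x y z * (a * b * c * u * u)"
      unfolding G g_def by (rule cert_theta[OF dv(1) _ _ _ u b c a]) (simp_all add: xyz)
    have 2: "fps_map theta Gy = (1 - y) * g y x z * (b * a * c * u * u)"
      unfolding G g_def sym(1)[symmetric]
      by (rule cert_theta[OF dv(2)])
         (use u sym a b c in \<open>simp_all add: xyz fps_map_const fps_map_X derivation_0[OF derivation_theta] derivation_1[OF derivation_theta]\<close>)
    have 3: "fps_map (fps_map theta) Gz = (1 - z) * g z x y * (c * a * b * u * u)"
      unfolding G g_def sym(2)[symmetric]
      by (rule cert_theta[OF dv(3)])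
         (use u sym a b c in \<open>simp_all add: xyz fps_map_const fps_map_X derivation_0[OF dv(1)] derivation_1[OF dv(1)] derivation_0[OF dv(2)] derivation_1[OF dv(2)]\<close>)
    have "theta Gx + fps_map theta Gy + fps_map (fps_map theta) Gz = ((1 - x) * g x y z + (1 - y) * g y x z + (1 - z) * g z x y) * (a * b * c * u * u)"
      unfolding 1 2 3 by (simp add: algebra_simps)
    also have "(1 - x) * g x y z + (1 - y) * g y x z + (1 - z) * g z x y
       = 2 * box_denom x y z * box_denom x y z - 2 * (1 - 5 * (x * y * z)) * box_denom x y z"
      unfolding g_def by (rule cert_divergence_poly)
    also have "\<dots> * (a * b * c * u * u) = 2 * (a * b * c) * (box_denom x y z * u) * (box_denom x y z * u)
        - 2 * (1 - 5 * (x * y * z)) * (a * b * c * u) * (box_denom x y z * u)"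
      by (simp add: algebra_simps)
    finally show ?thesis
      unfolding u by (simp add: algebra_simps)
  qed
  have main: "int n * diag (Gx + Gy + Gz) n = diag (theta Gx + fps_map theta Gy + fps_map (fps_map theta) Gz) n"
    by (simp add: diag_theta algebra_simps)
  have coeffs: "diag (a * b * c * u) m = C3 (Suc m)" "diag (a * b * c) m = 1" "diag u m = hat_coeff m m m" for m
    unfolding defs by (rule diag_sum_hat_fps diag_geometric diag_hat_fps)+
  have shift: "diag (x * y * z * F) m = (if m = 0 then 0 else diag F (m - 1))" for F m
    unfolding xyz by (rule diag_shift)
  have shift_C3: "diag (x * y * z * (a * b * c * u)) m = C3 m" for m
    by (cases m) (simp_all add: shift coeffs C3_eq_sum)
  from main show ?thesis
    unfolding sum div by (cases "n = 0") (simp_all add: coeffs shift_C3 shift[of u] shift[of "x * y * z * F" for F])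
qed

section \<open>Franel numbers\<close>

text \<open>
Choosing \<open>t2\<close> from \<open>a\<close> of the factors \<open>t2 + t3\<close>, \<open>t3\<close> from \<open>b\<close> of the factors \<open>t3 + t1\<close> and \<open>t1\<close> from \<open>c\<close> of the
factors \<open>t1 + t2\<close> produces the balanced monomial only for \<open>a = b = c\<close>.
\<close>

lemma hat_coeff_diagonal: "hat_coeff n n n = (\<Sum>k\<le>n. int (n choose k) ^ 3)"
proof -
  let ?x = "t_var 1" and ?y = "t_var 2" and ?z = "t_var 3"
  define m where "m = (\<lambda>a b c. (n choose a) * (n choose b) * (n choose c))"
  have of_nat: "coeff3 (of_nat l) 0 0 0 = int l" for l
    by (induction l) (simp_all add: coeff3_def lookup_add mono3_def)
  have expand: "hat_prod n n n = (?y + ?z) ^ n * (?z + ?x) ^ n * (?x + ?y) ^ n"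
    by (simp only: hat_prod_def hat_expand add.commute)
  have "hat_prod n n n = (\<Sum>a\<le>n. \<Sum>b\<le>n. \<Sum>c\<le>n. ?x ^ (n - b + c) * ?y ^ (a + (n - c)) * ?z ^ (n - a + b) * of_nat (m a b c))"
    unfolding expand binomial_ring sum_product3 by (intro sum.cong refl) (simp only: m_def power_add of_nat_mult mult_ac)
  then have "coeff3 (hat_prod n n n) n n n = (\<Sum>a\<le>n. \<Sum>b\<le>n. \<Sum>c\<le>n. coeff3 (?x ^ (n - b + c) * ?y ^ (a + (n - c)) * ?z ^ (n - a + b) * of_nat (m a b c)) n n n)"
    by (simp add: coeff3_def lookup_sum)
  also have "\<dots> = (\<Sum>a\<le>n. \<Sum>b\<le>n. \<Sum>c\<le>n. if c = a then if b = a then int (n choose a) ^ 3 else 0 else 0)"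
  proof (intro sum.cong refl)
    fix a b c assume abc: "a \<in> {..n}" "b \<in> {..n}" "c \<in> {..n}"
    show "coeff3 (?x ^ (n - b + c) * ?y ^ (a + (n - c)) * ?z ^ (n - a + b) * of_nat (m a b c)) n n n
        = (if c = a then if b = a then int (n choose a) ^ 3 else 0 else 0)"
    proof (cases "c = a \<and> b = a")
      case True
      then have [simp]: "c = a" "b = a"
        by auto
      have "n - a + a = n" "a + (n - a) = n"
        using abc by auto
      then show ?thesis
        unfolding coeff3_monomial_mult by (simp add: of_nat) (simp add: m_def power3_eq_cube)
    next
      case False
      have "c \<le> b" "a \<le> c" "b \<le> a" if "n - b + c \<le> n" "a + (n - c) \<le> n" "n - a + b \<le> n"
        using abc that by linarith+
      with False have "\<not> (n - b + c \<le> n \<and> a + (n - c) \<le> n \<and> n - a + b \<le> n)"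
        by (metis order_antisym order_trans)
      then show ?thesis
        unfolding coeff3_monomial_mult if_not_P[OF \<open>\<not> (n - b + c \<le> n \<and> a + (n - c) \<le> n \<and> n - a + b \<le> n)\<close>]
        using False by simp
    qed
  qed
  also have "\<dots> = (\<Sum>a\<le>n. int (n choose a) ^ 3)"
    by (intro sum.cong refl) (simp add: sum.delta)
  finally show ?thesis
    by (simp add: hat_coeff_def)
qed

definition franel :: "nat \<Rightarrow> real" where
  "franel n = (\<Sum>k\<le>n. real (n choose k) ^ 3)"

lemma franel_extend: "n \<le> m \<Longrightarrow> franel n = (\<Sum>k\<le>m. real (n choose k) ^ 3)"
  unfolding franel_def by (rule sum.mono_neutral_left) auto

text \<open>
Zeilberger's certificate for the cubes of the binomial coefficients, cleared of denominators: all
binomial coefficients are expressed through \<open>w = n! / (k! (n+2-k)!)\<close>, and \<open>w^3\<close> is cancelled. In this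
form there is no division by \<open>n+1-k\<close> or \<open>n+2-k\<close>, so the identity may be summed over all \<open>k \<le> n + 2\<close>.
\<close>

lemma franel_certificate:
  fixes n k :: real
  defines "g \<equiv> \<lambda>k. - (14 * n ^ 3 + 74 * n ^ 2 + 128 * n + 72) + (27 * n ^ 2 + 93 * n + 78) * k - (18 * n + 30) * k ^ 2 + 4 * k ^ 3"
  shows "(n + 2) ^ 2 * ((n + 1) * (n + 2)) ^ 3 - (7 * n ^ 2 + 21 * n + 16) * ((n + 1) * (n + 2 - k)) ^ 3
       - 8 * (n + 1) ^ 2 * ((n + 2 - k) * (n + 1 - k)) ^ 3
     = (n + 1) ^ 2 * ((n + 2 - k) ^ 3 * g (k + 1) - k ^ 3 * g k)"
  unfolding g_def by algebra

lemma franel_recurrence: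
  "real (n + 2) ^ 2 * franel (n + 2)
     = (7 * real n ^ 2 + 21 * real n + 16) * franel (n + 1) + 8 * real (n + 1) ^ 2 * franel n"
proof -
  let ?n = "real n"
  define q where "q = (?n + 1) * (?n + 2)"
  \<comment> \<open>This is \<open>n! / (k! (n+2-k)!)\<close>, through which all binomial coefficients of the three
    orders are polynomial multiples.\<close>
  define w where "w = (\<lambda>k. real (n + 2 choose k) / q)"
  define g where "g = (\<lambda>k::real. - (14 * ?n ^ 3 + 74 * ?n ^ 2 + 128 * ?n + 72) + (27 * ?n ^ 2 + 93 * ?n + 78) * k - (18 * ?n + 30) * k ^ 2 + 4 * k ^ 3)"
  define T where "T = (\<lambda>k. (?n + 1) ^ 2 * (real k * w k) ^ 3 * g (real k))"
  have q: "q > 0"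
    by (simp add: q_def)
  have absorb: "(real m + 1 - real k) * real (Suc m choose k) = (real m + 1) * real (m choose k)" for m k
  proof (cases "k \<le> Suc m")
    case True
    have "real ((Suc m - k) * (Suc m choose k)) = real (Suc m * (m choose k))"
      by (subst binomial_absorb_comp) simp
    moreover have "real (Suc m - k) = real m + 1 - real k" "real (Suc m) = real m + 1"
      using True by (simp_all add: of_nat_diff)
    ultimately show ?thesis
      by (simp only: of_nat_mult)
  qed (simp add: binomial_eq_0 not_le)
  have w2: "real (n + 2 choose k) = (?n + 1) * (?n + 2) * w k" for k
    using q by (simp add: w_def q_def)
  have w1: "real (n + 1 choose k) = (?n + 1) * (?n + 2 - k) * w k" for k
  proof -
    have "(?n + 2 - k) * real (n + 2 choose k) = (?n + 2) * real (n + 1 choose k)"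
      using absorb[of "n + 1" k] by (simp add: algebra_simps)
    then have "(?n + 2) * real (n + 1 choose k) = (?n + 2) * ((?n + 1) * (?n + 2 - k) * w k)"
      unfolding w2[of k] by (simp only: mult_ac)
    then show ?thesis
      by simp
  qed
  have w0: "real (n choose k) = (?n + 2 - k) * (?n + 1 - k) * w k" for k
  proof -
    have "(?n + 1 - k) * real (n + 1 choose k) = (?n + 1) * real (n choose k)"
      using absorb[of n k] by (simp add: algebra_simps)
    then have "(?n + 1) * real (n choose k) = (?n + 1) * ((?n + 2 - k) * (?n + 1 - k) * w k)"
      unfolding w1[of k] by (simp add: mult_ac)
    then show ?thesis
      by simp
  qed
  have w_Suc: "(real k + 1) * w (Suc k) = (?n + 2 - k) * w k" for k
  proof -
    have "real (Suc k * (n + 2 choose Suc k)) = real ((n + 2) * (n + 1 choose k))"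
      using Suc_times_binomial_eq[of "n + 1" k] by simp
    also have "\<dots> = (?n + 2 - k) * real (n + 2 choose k)"
      using absorb[of "n + 1" k] by (simp add: algebra_simps)
    finally show ?thesis
      using q by (simp add: w_def field_simps)
  qed
  have "real (n + 2) ^ 2 * real (n + 2 choose k) ^ 3 - (7 * ?n ^ 2 + 21 * ?n + 16) * real (n + 1 choose k) ^ 3
      - 8 * real (n + 1) ^ 2 * real (n choose k) ^ 3 = T (Suc k) - T k" for k
  proof -
    have "real (Suc k) * w (Suc k) = (?n + 2 - k) * w k" "real (Suc k) = real k + 1"
      using w_Suc[of k] by (simp_all add: add.commute)
    then have "T (Suc k) - T k = (?n + 1) ^ 2 * ((?n + 2 - k) * w k) ^ 3 * g (real k + 1) - (?n + 1) ^ 2 * (real k * w k) ^ 3 * g (real k)"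
      unfolding T_def by (simp only:)
    also have "\<dots> = (?n + 1) ^ 2 * ((?n + 2 - k) ^ 3 * g (real k + 1) - real k ^ 3 * g (real k)) * w k ^ 3"
      by (simp only: power_mult_distrib) (simp only: right_diff_distrib left_diff_distrib mult_ac)
    also have "\<dots> = ((?n + 2) ^ 2 * ((?n + 1) * (?n + 2)) ^ 3 - (7 * ?n ^ 2 + 21 * ?n + 16) * ((?n + 1) * (?n + 2 - k)) ^ 3
       - 8 * (?n + 1) ^ 2 * ((?n + 2 - k) * (?n + 1 - k)) ^ 3) * w k ^ 3"
      unfolding g_def by (subst franel_certificate) simp
    finally have *: "T (Suc k) - T k = \<dots>" .
    have "real (n + 2) = ?n + 2" "real (n + 1) = ?n + 1"
      by simp_all
    then show ?thesis
      unfolding * w0 w1 w2 by (simp only: power_mult_distrib) (simp only: left_diff_distrib right_diff_distrib mult_ac)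
  qed
  then have "(\<Sum>k\<le>n + 2. real (n + 2) ^ 2 * real (n + 2 choose k) ^ 3 - (7 * ?n ^ 2 + 21 * ?n + 16) * real (n + 1 choose k) ^ 3
      - 8 * real (n + 1) ^ 2 * real (n choose k) ^ 3) = (\<Sum>k<Suc (n + 2). T (Suc k) - T k)"
    by (simp only: lessThan_Suc_atMost)
  also have "\<dots> = T (Suc (n + 2)) - T 0"
    by (rule sum_lessThan_telescope)
  also have "\<dots> = 0"
  proof -
    \<comment> \<open>Both boundary terms vanish: \<open>w\<close> is zero beyond \<open>n + 2\<close>, and \<open>T 0\<close> has the factor \<open>0\<close>.\<close>
    have "w (Suc (n + 2)) = 0"
      by (simp add: w_def binomial_eq_0 del: binomial_Suc_Suc)
    then show ?thesis
      by (simp only: T_def) simp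
  qed
  finally have "real (n + 2) ^ 2 * (\<Sum>k\<le>n + 2. real (n + 2 choose k) ^ 3) - (7 * ?n ^ 2 + 21 * ?n + 16) * (\<Sum>k\<le>n + 2. real (n + 1 choose k) ^ 3)
      - 8 * real (n + 1) ^ 2 * (\<Sum>k\<le>n + 2. real (n choose k) ^ 3) = 0"
    by (simp only: sum_subtractf sum_distrib_left)
  then show ?thesis
    using franel_extend[of n "n + 2"] franel_extend[of "n + 1" "n + 2"] franel_extend[of "n + 2" "n + 2"] by simp
qed

lemma C3_recurrence:
  assumes "n \<ge> 1"
  shows "real (n + 1) * real_of_int (C3 (n + 1)) - (10 * real n + 5) * real_of_int (C3 n) + 9 * real n * real_of_int (C3 (n - 1))
     = 1 - real n * (3 * franel (n - 1) + franel n / 2)"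
proof -
  have f: "real_of_int (hat_coeff m m m) = franel m" for m
    by (simp add: hat_coeff_diagonal franel_def)
  have "int n * (2 * C3 (Suc n) - 20 * C3 n + 18 * C3 (n - 1) + 6 * hat_coeff (n - 1) (n - 1) (n - 1) + hat_coeff n n n)
     = 2 - 2 * C3 (Suc n) + 10 * C3 n"
    using C3_recurrence_int[of n] assms by simp
  then have "real_of_int (int n * (2 * C3 (Suc n) - 20 * C3 n + 18 * C3 (n - 1) + 6 * hat_coeff (n - 1) (n - 1) (n - 1) + hat_coeff n n n))
     = real_of_int (2 - 2 * C3 (Suc n) + 10 * C3 n)"
    by (rule arg_cong)
  then show ?thesis
    by (simp add: f algebra_simps)
qed

section \<open>The leading constant of the Franel numbers\<close>

lemma central_binomial_Suc:
  "(real n + 1) * real (2 * Suc n choose Suc n) = 2 * (2 * real n + 1) * real (2 * n choose n)"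
proof -
  have 1: "real (2 * n choose n) = fact (2 * n) / (fact n * fact n)"
    by (simp add: binomial_fact)
  have 2: "real (2 * Suc n choose Suc n) = fact (2 * Suc n) / (fact (Suc n) * fact (Suc n))"
    by (subst binomial_fact) (simp_all del: fact_Suc)
  have 3: "fact (2 * Suc n) = 2 * (real n + 1) * (2 * real n + 1) * fact (2 * n)"
    by (simp add: algebra_simps)
  have 4: "fact (Suc n) = (real n + 1) * fact n"
    by (simp add: add.commute)
  have *: "N * (2 * N * c * a / (N * b * (N * b))) = 2 * c * (a / (b * b))" if "N > 0" "b > 0" for N a b c :: real
    using that by (simp add: field_simps)
  then show ?thesis
    unfolding 1 2 3 4 by (intro *) auto
qed

lemma gbinomial_minus_half: "(- 1 / 2 :: real) gchoose n = (- 1) ^ n * real (2 * n choose n) / 4 ^ n"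
proof (induction n)
  case (Suc n)
  have "(- 1 / 2 :: real) gchoose Suc n = ((- 1 / 2) gchoose n) * (- 1 / 2 - real n) / (real n + 1)"
    using gbinomial_mult_1[of "- 1 / 2 :: real" n] by (simp add: field_simps)
  also have "\<dots> = (- 1) ^ Suc n * (2 * (2 * real n + 1) * real (2 * n choose n) / (real n + 1)) / 4 ^ Suc n"
  proof -
    have "s * c / p * (- 1 / 2 - x) / N = - s * (2 * (2 * x + 1) * c / N) / (4 * p)" if "N > 0" "p > 0" for s c p x N :: real
      using that by (simp add: field_simps)
    from this[of "real n + 1" "4 ^ n"] show ?thesis
      unfolding Suc.IH by simp
  qed
  also have "2 * (2 * real n + 1) * real (2 * n choose n) / (real n + 1) = real (2 * Suc n choose Suc n)"
    unfolding central_binomial_Suc[symmetric] by (simp del: binomial_Suc_Suc mult_Suc_right)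
  finally show ?case .
qed simp

text \<open>
The central binomial coefficients are, up to sign and a power of \<open>4\<close>, the generalised binomial
coefficients of \<open>-1/2\<close>, whose growth is governed by \<open>Gamma(1/2) = sqrt pi\<close>.
\<close>

lemma central_binomial_asymptotic:
  "(\<lambda>n. real (2 * n choose n) / 4 ^ n * sqrt (real n)) \<longlonglongrightarrow> 1 / sqrt pi"
proof -
  have "(\<lambda>n. ((- 1 / 2) gchoose n) / ((- 1) ^ n / exp ((- 1 / 2 + 1) * of_real (ln (real n))))) \<longlonglongrightarrow> inverse (Gamma (- (- 1 / 2) :: real))"
    by (rule gbinomial_asymptotic)
  also have "inverse (Gamma (- (- 1 / 2) :: real)) = 1 / sqrt pi"
    by (simp add: Gamma_one_half_real inverse_eq_divide)
  finally show ?thesis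
  proof (rule Lim_transform_eventually)
    show "\<forall>\<^sub>F n in sequentially. ((- 1 / 2) gchoose n) / ((- 1) ^ n / exp ((- 1 / 2 + 1) * of_real (ln (real n))))
       = real (2 * n choose n) / 4 ^ n * sqrt (real n)"
      using eventually_gt_at_top[of 0]
    proof eventually_elim
      case (elim n)
      then have "exp ((- 1 / 2 + 1) * ln (real n)) = sqrt (real n)"
        by (simp add: powr_half_sqrt[symmetric] powr_def)
      then show ?case
        using gbinomial_minus_half[of n] by simp
    qed
  qed
qed

text \<open>
The binomial coefficients of order \<open>2m\<close> relative to the central one. For \<open>j\<close> of order \<open>sqrt m\<close> this is close
to \<open>exp (- j^2 / m)\<close>, which \<open>binomial_ratio_upper\<close> and \<open>binomial_ratio_lower\<close> make precise with bounds
that hold for all \<open>j \<le> i\<close>.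
\<close>

definition binomial_ratio :: "nat \<Rightarrow> nat \<Rightarrow> real" where
  "binomial_ratio m j = real (2 * m choose (m + j)) / real (2 * m choose m)"

lemma binomial_ratio_0: "binomial_ratio m 0 = 1"
  by (simp add: binomial_ratio_def)

lemma binomial_ratio_Suc:
  assumes "j < m"
  shows "binomial_ratio m (Suc j) = binomial_ratio m j * ((real m - real j) / (real m + real j + 1))"
proof -
  have "Suc (m + j) * (2 * m choose Suc (m + j)) = (2 * m - (m + j)) * (2 * m choose (m + j))"
    by (metis binomial_absorption binomial_absorb_comp mult.commute)
  then have "real (Suc (m + j)) * real (2 * m choose Suc (m + j)) = real (2 * m - (m + j)) * real (2 * m choose (m + j))"
    by (metis of_nat_mult)
  also have "real (2 * m - (m + j)) = real m - real j"
    using assms by (simp add: of_nat_diff)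
  finally have "real (2 * m choose Suc (m + j)) = real (2 * m choose (m + j)) * ((real m - real j) / (real m + real j + 1))"
    by (simp add: eq_divide_eq mult_ac add_ac)
  then show ?thesis
    by (simp add: binomial_ratio_def)
qed

lemma binomial_ratio_nonneg: "0 \<le> binomial_ratio m j"
  by (simp add: binomial_ratio_def)

text \<open>
Each factor \<open>(m-j)/(m+j+1)\<close> is at most \<open>exp (- (2j+1)/(m+i))\<close>, and the odd numbers up to \<open>2j-1\<close> add up
to \<open>j^2\<close>. The parameter \<open>i\<close> serves two ends: \<open>i = j\<close> gives the sharp bound for the limit, and \<open>i = m\<close> a
Gaussian bound that is uniform in \<open>j\<close>.
\<close>

lemma binomial_ratio_upper:
  assumes "j \<le> i" "i \<le> m"
  shows "binomial_ratio m j \<le> exp (- (real j ^ 2) / (real m + real i))"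
  using assms(1)
proof (induction j)
  case (Suc j)
  have pos: "real m + real i > 0"
    using Suc.prems assms by simp
  have "(real m - real j) / (real m + real j + 1) = 1 - (2 * real j + 1) / (real m + real j + 1)"
    by (simp add: field_simps)
  also have "\<dots> \<le> 1 - (2 * real j + 1) / (real m + real i)"
    using Suc.prems pos by (intro diff_mono divide_left_mono mult_pos_pos) auto
  also have "\<dots> \<le> exp (- ((2 * real j + 1) / (real m + real i)))"
    using exp_ge_add_one_self[of "- ((2 * real j + 1) / (real m + real i))"] by simp
  finally have "binomial_ratio m j * ((real m - real j) / (real m + real j + 1)) \<le> exp (- (real j ^ 2) / (real m + real i)) * exp (- ((2 * real j + 1) / (real m + real i)))"
    using Suc assms by (intro mult_mono) (auto simp: binomial_ratio_nonneg)
  then have "binomial_ratio m (Suc j) \<le> exp (- (real j ^ 2) / (real m + real i)) * exp (- ((2 * real j + 1) / (real m + real i)))"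
    using Suc.prems assms by (subst binomial_ratio_Suc) auto
  also have "\<dots> = exp (- (real (Suc j) ^ 2) / (real m + real i))"
    unfolding exp_add[symmetric] by (simp add: power2_eq_square diff_divide_distrib[symmetric] add_divide_distrib[symmetric] algebra_simps)
  finally show ?case .
qed (simp add: binomial_ratio_0)

lemma binomial_ratio_lower:
  assumes "j \<le> i" "i < m"
  shows "exp (- (real j ^ 2) / (real m - real i)) \<le> binomial_ratio m j"
  using assms(1)
proof (induction j)
  case (Suc j)
  have pos: "real m - real i > 0" "real m - real j > 0"
    using Suc.prems assms by auto
  have "(real m + real j + 1) / (real m - real j) = 1 + (2 * real j + 1) / (real m - real j)"
    using pos by (simp add: field_simps)
  also have "\<dots> \<le> 1 + (2 * real j + 1) / (real m - real i)"
    using Suc.prems pos by (intro add_mono divide_left_mono mult_pos_pos) auto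
  also have "\<dots> \<le> exp ((2 * real j + 1) / (real m - real i))"
    by (rule exp_ge_add_one_self)
  finally have "(real m + real j + 1) / (real m - real j) \<le> exp ((2 * real j + 1) / (real m - real i))" .
  then have "inverse (exp ((2 * real j + 1) / (real m - real i))) \<le> inverse ((real m + real j + 1) / (real m - real j))"
    using pos by (intro le_imp_inverse_le) auto
  then have "exp (- ((2 * real j + 1) / (real m - real i))) \<le> (real m - real j) / (real m + real j + 1)"
    by (simp add: exp_minus)
  then have "exp (- (real j ^ 2) / (real m - real i)) * exp (- ((2 * real j + 1) / (real m - real i))) \<le> binomial_ratio m j * ((real m - real j) / (real m + real j + 1))"
    using Suc assms by (intro mult_mono) (auto simp: binomial_ratio_nonneg)
  then have "exp (- (real j ^ 2) / (real m - real i)) * exp (- ((2 * real j + 1) / (real m - real i))) \<le> binomial_ratio m (Suc j)"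
    using Suc.prems assms by (subst binomial_ratio_Suc) auto
  also have "exp (- (real j ^ 2) / (real m - real i)) * exp (- ((2 * real j + 1) / (real m - real i))) = exp (- (real (Suc j) ^ 2) / (real m - real i))"
    unfolding exp_add[symmetric] by (simp add: power2_eq_square diff_divide_distrib[symmetric] add_divide_distrib[symmetric] algebra_simps)
  finally show ?case .
qed (simp add: binomial_ratio_0)

lemma binomial_ratio_limit:
  assumes "x \<ge> 0"
  shows "(\<lambda>m. binomial_ratio m (nat \<lfloor>x * sqrt (real m)\<rfloor>)) \<longlonglongrightarrow> exp (- (x ^ 2))"
proof (rule tendsto_sandwich)
  define j where "j = (\<lambda>m. nat \<lfloor>x * sqrt (real m)\<rfloor>)"
  have rj: "real (j m) = of_int \<lfloor>x * sqrt (real m)\<rfloor>" for m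
    using assms by (simp add: j_def)
  have "(\<lambda>m. real (j m) / sqrt (real m)) \<longlonglongrightarrow> x"
  proof (rule tendsto_sandwich)
    show "\<forall>\<^sub>F m in sequentially. x - 1 / sqrt (real m) \<le> real (j m) / sqrt (real m)"
      using eventually_gt_at_top[of 0]
    proof eventually_elim
      case (elim m)
      have "x * sqrt (real m) - 1 \<le> real (j m)"
        unfolding rj by linarith
      then have "(x * sqrt (real m) - 1) / sqrt (real m) \<le> real (j m) / sqrt (real m)"
        by (intro divide_right_mono) auto
      moreover have "(x * s - 1) / s = x - 1 / s" if "s > 0" for s :: real
        using that by (simp add: field_simps)
      ultimately show ?case
        using elim by simp
    qed
    show "\<forall>\<^sub>F m in sequentially. real (j m) / sqrt (real m) \<le> x"
      using eventually_gt_at_top[of 0]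
    proof eventually_elim
      case (elim m)
      have "real (j m) \<le> x * sqrt (real m)"
        unfolding rj by linarith
      with elim show ?case
        by (simp add: field_simps)
    qed
    show "(\<lambda>m. x - 1 / sqrt (real m)) \<longlonglongrightarrow> x"
      by real_asymp
  qed simp
  note lim1 = this
  have lim2: "(\<lambda>m. 1 / sqrt (real m)) \<longlonglongrightarrow> 0"
    by real_asymp
  note lim = tendsto_power[OF lim1, of 2] tendsto_mult[OF lim1 lim2]
  have eq: "real (j m) ^ 2 / (real m + s * real (j m)) = (real (j m) / sqrt (real m)) ^ 2 / (1 + s * ((real (j m) / sqrt (real m)) * (1 / sqrt (real m))))"
    if "m > 0" for m s
  proof -
    have "(real (j m) / sqrt (real m)) * (1 / sqrt (real m)) = real (j m) / real m"
      by simp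
    then have "1 + s * ((real (j m) / sqrt (real m)) * (1 / sqrt (real m))) = (real m + s * real (j m)) / real m"
      using that by (simp only:) (simp add: add_divide_distrib)
    moreover have "(real (j m) / sqrt (real m)) ^ 2 = real (j m) ^ 2 / real m"
      by (simp add: power_divide)
    ultimately show ?thesis
      using that by simp
  qed
  have main: "(\<lambda>m. exp (- (real (j m) ^ 2 / (real m + s * real (j m))))) \<longlonglongrightarrow> exp (- (x ^ 2))" for s
  proof -
    have "(\<lambda>m. (real (j m) / sqrt (real m)) ^ 2 / (1 + s * ((real (j m) / sqrt (real m)) * (1 / sqrt (real m))))) \<longlonglongrightarrow> x ^ 2 / (1 + s * (x * 0))"
      by (intro tendsto_intros lim) auto
    then have "(\<lambda>m. real (j m) ^ 2 / (real m + s * real (j m))) \<longlonglongrightarrow> x ^ 2 / (1 + s * (x * 0))"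
      by (rule Lim_transform_eventually) (rule eventually_mono[OF eventually_gt_at_top[of 0] eq[symmetric]])
    then show ?thesis
      by (intro tendsto_exp tendsto_minus) simp
  qed
  have small: "\<forall>\<^sub>F m in sequentially. j m < m"
  proof -
    have "\<forall>\<^sub>F m in sequentially. real (j m) / sqrt (real m) * (1 / sqrt (real m)) < 1"
      using lim(2) by (rule order_tendstoD) simp
    then show ?thesis
      using eventually_gt_at_top[of 0] by eventually_elim simp
  qed
  show "(\<lambda>m. exp (- (real (j m) ^ 2 / (real m + (- 1) * real (j m))))) \<longlonglongrightarrow> exp (- (x ^ 2))"
    by (rule main)
  show "(\<lambda>m. exp (- (real (j m) ^ 2 / (real m + 1 * real (j m))))) \<longlonglongrightarrow> exp (- (x ^ 2))"
    by (rule main)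
  show "\<forall>\<^sub>F m in sequentially. exp (- (real (j m) ^ 2 / (real m + (- 1) * real (j m)))) \<le> binomial_ratio m (nat \<lfloor>x * sqrt (real m)\<rfloor>)"
    using small
  proof eventually_elim
    case (elim m)
    then show ?case
      using binomial_ratio_lower[of "j m" "j m" m] by (simp add: j_def)
  qed
  show "\<forall>\<^sub>F m in sequentially. binomial_ratio m (nat \<lfloor>x * sqrt (real m)\<rfloor>) \<le> exp (- (real (j m) ^ 2 / (real m + 1 * real (j m))))"
    using small
  proof eventually_elim
    case (elim m)
    then show ?case
      using binomial_ratio_upper[of "j m" "j m" m] by (simp add: j_def)
  qed
qed

lemma gaussian_half_line:
  assumes "a > 0"
  shows "has_bochner_integral lborel (\<lambda>x. indicator {0..} x *\<^sub>R exp (- (a * x ^ 2))) (sqrt (pi / a) / 2)"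
proof -
  have "has_bochner_integral lborel (\<lambda>x. indicator {0..} (0 + sqrt a * x) *\<^sub>R exp (- (0 + sqrt a * x)\<^sup>2)) ((sqrt pi / 2) /\<^sub>R \<bar>sqrt a\<bar>)"
    using gaussian_moment_0 assms by (subst (asm) lborel_has_bochner_integral_real_affine_iff[of "sqrt a" _ _ 0]) auto
  moreover have "(\<lambda>x. indicator {0..} (0 + sqrt a * x) *\<^sub>R exp (- (0 + sqrt a * x)\<^sup>2)) = (\<lambda>x. indicator {0..} x *\<^sub>R exp (- (a * x ^ 2)))"
    using assms by (auto simp: fun_eq_iff indicator_def power_mult_distrib zero_le_mult_iff)
  moreover have "(sqrt pi / 2) /\<^sub>R \<bar>sqrt a\<bar> = sqrt (pi / a) / 2"
    using assms by (simp add: real_sqrt_divide) (simp only: divide_inverse mult.commute)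
  ultimately show ?thesis
    by simp
qed

text \<open>
The sum divided by \<open>sqrt m\<close> is the integral over \<open>x \<ge> 0\<close> of the step function
\<open>binomial_ratio m \<lfloor>x sqrt m\<rfloor> ^ 3\<close>, which tends to \<open>exp (- 3 x^2)\<close> pointwise. The uniform Gaussian upper
bound allows dominated convergence.
\<close>

lemma binomial_ratio_sum_limit:
  "(\<lambda>m. (\<Sum>j\<le>m. binomial_ratio m j ^ 3) / sqrt (real m)) \<longlonglongrightarrow> sqrt (pi / 3) / 2"
proof -
  define h where "h = (\<lambda>m x. indicator {0..} x *\<^sub>R binomial_ratio m (nat \<lfloor>x * sqrt (real m)\<rfloor>) ^ 3)"
  define w where "w = (\<lambda>x::real. exp (3 / 2) * (indicator {0..} x *\<^sub>R exp (- (3 / 4 * x ^ 2))))"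
  define g where "g = (\<lambda>x::real. indicator {0..} x *\<^sub>R exp (- (3 * x ^ 2)))"
  have g: "has_bochner_integral lborel g (sqrt (pi / 3) / 2)"
    unfolding g_def by (rule gaussian_half_line) simp
  have step: "h m \<in> borel_measurable lborel"
    "integral\<^sup>L lborel (h m) = (\<Sum>j\<le>m. binomial_ratio m j ^ 3) / sqrt (real m)" if "m > 0" for m
  proof -
    define s where "s = sqrt (real m)"
    have s: "s > 0"
      using that by (simp add: s_def)
    have h_eq: "h m x = (\<Sum>j\<le>m. indicator {real j / s..<real (Suc j) / s} x *\<^sub>R binomial_ratio m j ^ 3)" for x
    proof (cases "x \<ge> 0")
      case True
      define k where "k = nat \<lfloor>x * s\<rfloor>"
      have iff: "x \<in> {real j / s..<real (Suc j) / s} \<longleftrightarrow> j = k" for j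
      proof -
        have "x \<in> {real j / s..<real (Suc j) / s} \<longleftrightarrow> real j \<le> x * s \<and> x * s < real j + 1"
          using s by (simp add: divide_le_eq less_divide_eq add.commute)
        also have "\<dots> \<longleftrightarrow> \<lfloor>x * s\<rfloor> = int j"
          by (simp add: floor_eq_iff)
        also have "\<dots> \<longleftrightarrow> j = k"
          using True s by (auto simp: k_def)
        finally show ?thesis .
      qed
      have "(\<Sum>j\<le>m. indicator {real j / s..<real (Suc j) / s} x *\<^sub>R binomial_ratio m j ^ 3) = (\<Sum>j\<le>m. if j = k then binomial_ratio m j ^ 3 else 0)"
        by (intro sum.cong refl) (simp only: indicator_def iff, simp)
      also have "\<dots> = binomial_ratio m k ^ 3"
        by (simp add: sum.delta binomial_ratio_def)
      finally show ?thesis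
        using True by (simp add: h_def k_def s_def)
    next
      case False
      have "x \<notin> {real j / s..<real (Suc j) / s}" for j
      proof -
        have "0 \<le> real j / s"
          using s by simp
        with False have "\<not> real j / s \<le> x"
          by linarith
        then show ?thesis
          by simp
      qed
      with False show ?thesis
        by (simp add: h_def)
    qed
    have cell: "integrable lborel (indicator {a..<b} :: real \<Rightarrow> real)" for a b :: real
      by (cases "a \<le> b") (auto intro!: integrable_real_indicator)
    have "integral\<^sup>L lborel (h m) = (\<Sum>j\<le>m. integral\<^sup>L lborel (\<lambda>x. indicator {real j / s..<real (Suc j) / s} x *\<^sub>R binomial_ratio m j ^ 3))"
      unfolding h_eq[abs_def] by (intro Bochner_Integration.integral_sum integrable_scaleR_left cell)
    also have "\<dots> = (\<Sum>j\<le>m. 1 / s * binomial_ratio m j ^ 3)"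
    proof (intro sum.cong refl)
      fix j
      have "real j / s \<le> real (Suc j) / s"
        using s by (intro divide_right_mono) auto
      then have "measure lborel {real j / s..<real (Suc j) / s} = real (Suc j) / s - real j / s"
        by (rule measure_lborel_Ico)
      also have "\<dots> = 1 / s"
        unfolding diff_divide_distrib[symmetric] by simp
      finally have "integral\<^sup>L lborel (indicator {real j / s..<real (Suc j) / s}) = 1 / s"
        by simp
      then show "integral\<^sup>L lborel (\<lambda>x. indicator {real j / s..<real (Suc j) / s} x *\<^sub>R binomial_ratio m j ^ 3)
          = 1 / s * binomial_ratio m j ^ 3"
        by (subst integral_scaleR_left[OF cell]) (simp only: real_scaleR_def)
    qed
    also have "\<dots> = (\<Sum>j\<le>m. binomial_ratio m j ^ 3) / s"
      by (simp add: sum_divide_distrib)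
    finally show "integral\<^sup>L lborel (h m) = (\<Sum>j\<le>m. binomial_ratio m j ^ 3) / sqrt (real m)"
      by (simp add: s_def)
    show "h m \<in> borel_measurable lborel"
      unfolding h_eq[abs_def] by measurable
  qed
  have w: "integrable lborel w"
    using gaussian_half_line[of "3 / 4"] unfolding w_def has_bochner_integral_iff by simp
  have dom: "norm (h m x) \<le> w x" if "m > 0" for m x
  proof (cases "x \<ge> 0")
    case True
    define k where "k = nat \<lfloor>x * sqrt (real m)\<rfloor>"
    define y where "y = real k / sqrt (real m)"
    have "x * sqrt (real m) - 1 \<le> real k"
      unfolding k_def using True by linarith
    then have "x * sqrt (real m) / sqrt (real m) - 1 / sqrt (real m) \<le> y"
      unfolding y_def diff_divide_distrib[symmetric] by (intro divide_right_mono) auto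
    moreover have "1 / sqrt (real m) \<le> 1"
      using that by simp
    moreover have "x * sqrt (real m) / sqrt (real m) = x"
      using that by simp
    \<comment> \<open>Rounding down costs at most \<open>1 / sqrt m \<le> 1\<close>, which is absorbed by \<open>x^2 \<le> 2 y^2 + 2\<close> below;
      this is where the weaker rate \<open>3/4\<close> and the factor \<open>exp (3/2)\<close> of the majorant come from.\<close>
    ultimately have y: "x - 1 \<le> y"
      by linarith
    have "binomial_ratio m k \<le> exp (- (y ^ 2 / 2))"
    proof (cases "k \<le> m")
      case True
      have "y ^ 2 / 2 = real k ^ 2 / (real m + real m)"
        by (simp add: y_def power_divide)
      with True show ?thesis
        using binomial_ratio_upper[of k m m] by (simp add: mult.commute)
    next
      case False
      then show ?thesis
        by (simp add: binomial_ratio_def binomial_eq_0)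
    qed
    then have "binomial_ratio m k ^ 3 \<le> exp (- (y ^ 2 / 2)) ^ 3"
      by (rule power_mono) (rule binomial_ratio_nonneg)
    also have "\<dots> = exp (- (3 / 2) * y ^ 2)"
      by (subst exp_of_nat_mult[symmetric]) simp
    also have "\<dots> \<le> exp (3 / 2 + - (3 / 4 * x ^ 2))"
    proof -
      have "0 \<le> y"
        by (simp add: y_def)
      then have "x ^ 2 \<le> (y + 1) ^ 2"
        using y True by (intro power_mono) auto
      moreover have "(y + 1) ^ 2 + (y - 1) ^ 2 = 2 * y ^ 2 + 2"
        by (simp add: power2_eq_square algebra_simps)
      ultimately have "x ^ 2 \<le> 2 * y ^ 2 + 2"
        using zero_le_power2[of "y - 1"] by linarith
      then show ?thesis
        by simp
    qed
    also have "\<dots> = exp (3 / 2) * exp (- (3 / 4 * x ^ 2))"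
      by (rule exp_add)
    finally show ?thesis
      using True by (simp add: h_def w_def k_def binomial_ratio_nonneg)
  qed (simp add: h_def w_def)
  have "(\<lambda>m. integral\<^sup>L lborel (h (Suc m))) \<longlonglongrightarrow> integral\<^sup>L lborel g"
  proof (rule integral_dominated_convergence[where w = w])
    show "g \<in> borel_measurable lborel"
      using g by (rule borel_measurable_has_bochner_integral)
    show "h (Suc m) \<in> borel_measurable lborel" for m
      by (rule step) simp
    show "integrable lborel w"
      by (rule w)
    show "AE x in lborel. norm (h (Suc m) x) \<le> w x" for m
      using dom by simp
    have "(\<lambda>m. h m x) \<longlonglongrightarrow> g x" for x
    proof (cases "x \<ge> 0")
      case True
      have "(\<lambda>m. binomial_ratio m (nat \<lfloor>x * sqrt (real m)\<rfloor>) ^ 3) \<longlonglongrightarrow> exp (- (x ^ 2)) ^ 3"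
        by (intro tendsto_power binomial_ratio_limit True)
      also have "exp (- (x ^ 2)) ^ 3 = exp (- (3 * x ^ 2))"
        by (subst exp_of_nat_mult[symmetric]) simp
      finally show ?thesis
        using True by (simp add: h_def g_def)
    qed (simp add: h_def g_def)
    then show "AE x in lborel. (\<lambda>m. h (Suc m) x) \<longlonglongrightarrow> g x"
      by (intro AE_I2 LIMSEQ_Suc)
  qed
  also have "(\<lambda>m. integral\<^sup>L lborel (h (Suc m))) = (\<lambda>m. (\<Sum>j\<le>Suc m. binomial_ratio (Suc m) j ^ 3) / sqrt (real (Suc m)))"
    by (intro ext step) simp
  also have "integral\<^sup>L lborel g = sqrt (pi / 3) / 2"
    using g by (rule has_bochner_integral_integral_eq)
  finally show ?thesis
    by (rule LIMSEQ_imp_Suc)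
qed

text \<open>
The sum of cubes is symmetric about its central term, so it is twice the one-sided sum of the previous
lemma minus that term; the subtracted term is negligible after division by \<open>sqrt m\<close>. Even
indices suffice, since the recurrence shows by itself that the whole sequence converges.
\<close>

lemma franel_even_limit: "(\<lambda>m. real (2 * m) * franel (2 * m) / 8 ^ (2 * m)) \<longlonglongrightarrow> 2 / (sqrt 3 * pi)"
proof -
  define c where "c = (\<lambda>m. real (2 * m choose m))"
  have sum: "franel (2 * m) = c m ^ 3 * (2 * (\<Sum>j\<le>m. binomial_ratio m j ^ 3) - 1)" for m
  proof -
    have ratio: "real (2 * m choose (m + j)) = c m * binomial_ratio m j" for j
      by (simp add: binomial_ratio_def c_def)
    have upper: "(\<Sum>k\<in>{m..2 * m}. real (2 * m choose k) ^ 3) = c m ^ 3 * (\<Sum>j\<le>m. binomial_ratio m j ^ 3)"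
    proof -
      have "(\<Sum>k\<in>{m..2 * m}. real (2 * m choose k) ^ 3) = (\<Sum>j\<le>m. real (2 * m choose (m + j)) ^ 3)"
        by (rule sum.reindex_bij_witness[of _ "\<lambda>j. m + j" "\<lambda>k. k - m"]) auto
      then show ?thesis
        by (simp add: ratio power_mult_distrib sum_distrib_left)
    qed
    have lower: "(\<Sum>k\<le>m. real (2 * m choose k) ^ 3) = (\<Sum>k\<in>{m..2 * m}. real (2 * m choose k) ^ 3)"
    proof (rule sum.reindex_bij_witness[of _ "\<lambda>k. 2 * m - k" "\<lambda>k. 2 * m - k"])
      fix k assume "k \<in> {..m}"
      then show "real (2 * m choose (2 * m - k)) ^ 3 = real (2 * m choose k) ^ 3"
        by (subst binomial_symmetric[of k]) auto
    qed auto
    have "{..2 * m} = {..m} \<union> {m..2 * m}" "{..m} \<inter> {m..2 * m} = {m}"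
      by auto
    then have "franel (2 * m) = (\<Sum>k\<le>m. real (2 * m choose k) ^ 3) + (\<Sum>k\<in>{m..2 * m}. real (2 * m choose k) ^ 3) - c m ^ 3"
      unfolding franel_def by (simp add: sum_Un c_def)
    then show ?thesis
      unfolding lower upper by (simp add: algebra_simps)
  qed
  have "(\<lambda>m. 2 * (c m / 4 ^ m * sqrt (real m)) ^ 3 * (2 * ((\<Sum>j\<le>m. binomial_ratio m j ^ 3) / sqrt (real m)) - 1 / sqrt (real m)))
      \<longlonglongrightarrow> 2 * (1 / sqrt pi) ^ 3 * (2 * (sqrt (pi / 3) / 2) - 0)"
    unfolding c_def
    by (intro tendsto_intros central_binomial_asymptotic binomial_ratio_sum_limit) real_asymp
  also have "2 * (1 / sqrt pi) ^ 3 * (2 * (sqrt (pi / 3) / 2) - 0) = 2 / (sqrt 3 * pi)"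
  proof -
    have "2 * (1 / p) ^ 3 * (2 * (p / t / 2) - 0) = 2 / (t * (p * p))" if "p > 0" "t > 0" for p t :: real
      using that by (simp add: power3_eq_cube)
    from this[of "sqrt pi" "sqrt 3"] show ?thesis
      by (simp add: real_sqrt_divide)
  qed
  finally show ?thesis
  proof (rule Lim_transform_eventually)
    show "\<forall>\<^sub>F m in sequentially. 2 * (c m / 4 ^ m * sqrt (real m)) ^ 3 * (2 * ((\<Sum>j\<le>m. binomial_ratio m j ^ 3) / sqrt (real m)) - 1 / sqrt (real m))
       = real (2 * m) * franel (2 * m) / 8 ^ (2 * m)"
      using eventually_gt_at_top[of 0]
    proof eventually_elim
      case (elim m)
      define s where "s = sqrt (real m)"
      have s: "s > 0" "real m = s * s"
        using elim by (simp_all add: s_def)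
      have "(8::real) ^ (2 * m) = (4 ^ m) ^ 3"
      proof -
        have "((4::real) ^ m) ^ 3 = (4 ^ 3) ^ m"
          by (simp only: power_mult[symmetric] mult.commute)
        then show ?thesis
          by (simp add: power_mult)
      qed
      moreover have "(C / p * s) ^ 3 * (2 * (S / s) - 1 / s) = s * s * (C ^ 3 * (2 * S - 1) / p ^ 3)" for C p S
      proof -
        have "2 * (S / s) - 1 / s = (2 * S - 1) / s"
          by (simp add: diff_divide_distrib)
        then show ?thesis
          using s(1) by (simp add: power_mult_distrib power_divide power3_eq_cube mult_ac)
      qed
      ultimately show ?case
        unfolding sum s_def[symmetric] by (simp add: s(2) mult.assoc)
    qed
  qed
qed

section \<open>Null solutions of perturbed second-order recurrences\<close>

lemma bigo_inverse_powerE: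
  assumes "(f :: nat \<Rightarrow> real) \<in> O(\<lambda>n. 1 / real n ^ s)"
  obtains C where "C > 0" "\<forall>\<^sub>F n in sequentially. \<bar>f n\<bar> \<le> C / real n ^ s"
  using assms by (elim landau_o.bigE) simp

lemma bigo_inverse_powerI:
  assumes "\<forall>\<^sub>F n in sequentially. \<bar>f n\<bar> \<le> C / real n ^ s"
  shows "(f :: nat \<Rightarrow> real) \<in> O(\<lambda>n. 1 / real n ^ s)"
  using assms by (intro bigoI[of _ C]) simp

text \<open>
The contraction by \<open>1/2\<close> beats the decay of \<open>1 / n^s\<close> from one index to the next, whose ratio tends to \<open>1\<close>.
\<close>

lemma halving_recursion_bigo:
  fixes d :: "nat \<Rightarrow> real"
  assumes "\<forall>\<^sub>F n in sequentially. \<bar>d (Suc n)\<bar> \<le> \<bar>d n\<bar> / 2 + C / real n ^ s"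
  shows "d \<in> O(\<lambda>n. 1 / real n ^ s)"
proof -
  have "(\<lambda>n. ((real n + 1) / real n) ^ s) \<longlonglongrightarrow> 1 ^ s"
    by (intro tendsto_power) real_asymp
  then have "\<forall>\<^sub>F n in sequentially. ((real n + 1) / real n) ^ s < 3 / 2"
    by (rule order_tendstoD) simp
  then have "\<forall>\<^sub>F n in sequentially. ((real n + 1) / real n) ^ s < 3 / 2 \<and> n > 0 \<and> \<bar>d (Suc n)\<bar> \<le> \<bar>d n\<bar> / 2 + C / real n ^ s"
    using assms by (intro eventually_conj eventually_gt_at_top)
  then obtain N where N: "\<And>n. n \<ge> N \<Longrightarrow> ((real n + 1) / real n) ^ s < 3 / 2 \<and> n > 0 \<and> \<bar>d (Suc n)\<bar> \<le> \<bar>d n\<bar> / 2 + C / real n ^ s"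
    unfolding eventually_sequentially by blast
  \<comment> \<open>The first entry starts the induction. The second makes the step work:
    \<open>1/2 + 1/6 = 2/3\<close> compensates the ratio \<open>3/2\<close> of consecutive weights.\<close>
  define M where "M = max (\<bar>d N\<bar> * real N ^ s) (6 * \<bar>C\<bar>)"
  have "\<bar>d n\<bar> \<le> M / real n ^ s" if "n \<ge> N" for n
    using that
  proof (induction n rule: dec_induct)
    case base
    have "real N ^ s > 0"
      using N[of N] by simp
    then show ?case
      by (simp add: pos_le_divide_eq M_def)
  next
    case (step n)
    have pos: "real n ^ s > 0" "real (Suc n) ^ s > 0"
      using N[of n] step by auto
    have "\<bar>d (Suc n)\<bar> \<le> \<bar>d n\<bar> / 2 + C / real n ^ s"
      using N[of n] step by auto
    also have "\<dots> \<le> (M / real n ^ s) / 2 + (M / 6) / real n ^ s"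
      using step pos by (intro add_mono divide_right_mono) (auto simp: M_def)
    also have "\<dots> = (2 / 3 * M) / real n ^ s"
      by (simp add: field_simps)
    also have "\<dots> \<le> M / real (Suc n) ^ s"
    proof -
      have "real (Suc n) ^ s / real n ^ s < 3 / 2"
        using N[of n] step by (simp add: power_divide add.commute)
      then have "real (Suc n) ^ s \<le> 3 / 2 * real n ^ s"
        using pos by (simp add: pos_divide_less_eq)
      moreover have "M \<ge> 0"
        by (simp add: M_def le_max_iff_disj)
      ultimately have "2 / 3 * M * real (Suc n) ^ s \<le> 2 / 3 * M * (3 / 2 * real n ^ s)"
        by (intro mult_left_mono) auto
      then show ?thesis
        using pos by (simp add: pos_le_divide_eq pos_divide_le_eq mult_ac)
    qed
    finally show ?case .
  qed
  then show ?thesis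
    by (intro bigo_inverse_powerI eventually_sequentiallyI)
qed

lemma inverse_power_diff_lower:
  assumes "n > 0" "s > 0"
  shows "1 / (2 * real n ^ (s + 1)) \<le> 1 / real n ^ s - 1 / real (Suc n) ^ s"
proof -
  obtain t where t: "s = Suc t"
    using assms by (cases s) auto
  define x where "x = real n"
  have x: "x \<ge> 1"
    using assms by (simp add: x_def)
  have "1 / (x + 1) ^ s \<le> 1 / (x ^ t * (x + 1))"
    using x unfolding t power_Suc by (intro divide_left_mono mult_pos_pos) (auto intro!: mult_mono power_mono simp: mult.commute[of "x + 1"])
  moreover have "1 / x ^ s - 1 / (x ^ t * (x + 1)) = 1 / (x ^ t * (x * (x + 1)))"
    using x by (simp add: t divide_simps)
  moreover have "1 / (2 * x ^ (s + 1)) \<le> 1 / (x ^ t * (x * (x + 1)))"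
    using x by (intro divide_left_mono) (auto simp: t mult_ac intro!: mult_left_mono)
  ultimately show ?thesis
    by (simp add: x_def add.commute)
qed

text \<open>
A discrete form of integrating from \<open>n\<close> to infinity. Instead of summing a tail, the proof observes
that \<open>e n + 2 C / n^s\<close> decreases and \<open>e n - 2 C / n^s\<close> increases, both to the limit \<open>0\<close>.
\<close>

lemma null_sequence_bigo:
  fixes e :: "nat \<Rightarrow> real"
  assumes "(\<lambda>n. e (Suc n) - e n) \<in> O(\<lambda>n. 1 / real n ^ (s + 1))" and "e \<longlonglongrightarrow> 0" and "s > 0"
  shows "e \<in> O(\<lambda>n. 1 / real n ^ s)"
proof -
  obtain C where C: "C > 0" "\<forall>\<^sub>F n in sequentially. \<bar>e (Suc n) - e n\<bar> \<le> C / real n ^ (s + 1)"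
    using assms(1) by (rule bigo_inverse_powerE)
  then obtain N where N: "\<And>n. n \<ge> N \<Longrightarrow> \<bar>e (Suc n) - e n\<bar> \<le> C / real n ^ (s + 1)"
    unfolding eventually_sequentially by blast
  define N' where "N' = max 1 N"
  have diff: "\<bar>e (Suc n) - e n\<bar> \<le> 2 * C / real n ^ s - 2 * C / real (Suc n) ^ s" if "n \<ge> N'" for n
  proof -
    have "\<bar>e (Suc n) - e n\<bar> \<le> 2 * C * (1 / (2 * real n ^ (s + 1)))"
      using N[of n] that by (simp add: N'_def)
    also have "\<dots> \<le> 2 * C * (1 / real n ^ s - 1 / real (Suc n) ^ s)"
      using inverse_power_diff_lower[of n s] assms(3) C(1) that by (intro mult_left_mono) (auto simp: N'_def)
    finally show ?thesis
      by (simp add: right_diff_distrib)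
  qed
  have lim: "(\<lambda>n. 2 * C / real n ^ s) \<longlonglongrightarrow> 0"
    using assms(3) by (intro real_tendsto_divide_at_top[OF tendsto_const] filterlim_pow_at_top filterlim_real_sequentially)
  have "\<bar>e n\<bar> \<le> 2 * C / real n ^ s" if n: "n \<ge> N'" for n
  proof -
    have "0 \<le> e n + 2 * C / real n ^ s"
    proof (rule LIMSEQ_le_const2[where X = "\<lambda>m. e m + 2 * C / real m ^ s"])
      show "(\<lambda>m. e m + 2 * C / real m ^ s) \<longlonglongrightarrow> 0"
        using tendsto_add[OF assms(2) lim] by simp
      have "e m + 2 * C / real m ^ s \<le> e n + 2 * C / real n ^ s" if "m \<ge> n" for m
        using that
      proof (induction m rule: dec_induct)
        case (step k)
        then show ?case
          using diff[of k] n by linarith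
      qed simp
      then show "\<exists>K. \<forall>m\<ge>K. e m + 2 * C / real m ^ s \<le> e n + 2 * C / real n ^ s"
        by blast
    qed
    moreover have "e n - 2 * C / real n ^ s \<le> 0"
    proof (rule LIMSEQ_le_const[where X = "\<lambda>m. e m - 2 * C / real m ^ s"])
      show "(\<lambda>m. e m - 2 * C / real m ^ s) \<longlonglongrightarrow> 0"
        using tendsto_diff[OF assms(2) lim] by simp
      have "e n - 2 * C / real n ^ s \<le> e m - 2 * C / real m ^ s" if "m \<ge> n" for m
        using that
      proof (induction m rule: dec_induct)
        case (step k)
        then show ?case
          using diff[of k] n by linarith
      qed simp
      then show "\<exists>K. \<forall>m\<ge>K. e n - 2 * C / real n ^ s \<le> e m - 2 * C / real m ^ s"
        by blast
    qed
    ultimately show ?thesis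
      by linarith
  qed
  then show ?thesis
    by (intro bigo_inverse_powerI eventually_sequentiallyI)
qed

text \<open>
The recurrence is written for the differences \<open>e (n+1) - e n\<close>: they contract because of the
coefficient \<open>\<alpha>\<close>, and are driven by terms that are smaller than \<open>e\<close> by a factor \<open>1 / n^2\<close>.
\<close>

lemma difference_bigo:
  fixes e \<alpha> \<beta> r :: "nat \<Rightarrow> real"
  assumes rec: "\<forall>\<^sub>F n in sequentially. e (Suc (Suc n)) - e (Suc n) = - \<alpha> n * (e (Suc n) - e n) + \<beta> n * e (Suc n) + r n"
    and \<alpha>: "\<forall>\<^sub>F n in sequentially. \<bar>\<alpha> n\<bar> \<le> 1 / 2"
    and \<beta>: "\<beta> \<in> O(\<lambda>n. 1 / real n ^ 2)"
    and r: "r \<in> O(\<lambda>n. 1 / real n ^ (k + 2))"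
    and e: "e \<in> O(\<lambda>n. 1 / real n ^ k)"
  shows "(\<lambda>n. e (Suc n) - e n) \<in> O(\<lambda>n. 1 / real n ^ (k + 2))"
proof -
  obtain B where B: "B > 0" "\<forall>\<^sub>F n in sequentially. \<bar>\<beta> n\<bar> \<le> B / real n ^ 2"
    using \<beta> by (rule bigo_inverse_powerE)
  obtain R where R: "R > 0" "\<forall>\<^sub>F n in sequentially. \<bar>r n\<bar> \<le> R / real n ^ (k + 2)"
    using r by (rule bigo_inverse_powerE)
  obtain E where E: "E > 0" "\<forall>\<^sub>F n in sequentially. \<bar>e n\<bar> \<le> E / real n ^ k"
    using e by (rule bigo_inverse_powerE)
  have E': "\<forall>\<^sub>F n in sequentially. \<bar>e (Suc n)\<bar> \<le> E / real (Suc n) ^ k"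
    using E(2) by (rule eventually_compose_filterlim[OF _ filterlim_Suc])
  have "\<forall>\<^sub>F n in sequentially. \<bar>e (Suc (Suc n)) - e (Suc n)\<bar> \<le> \<bar>e (Suc n) - e n\<bar> / 2 + (B * E + R) / real n ^ (k + 2)"
    using rec \<alpha> B(2) R(2) E' eventually_gt_at_top[of 0]
  proof eventually_elim
    case (elim n)
    have "\<bar>e (Suc n)\<bar> \<le> E / real n ^ k"
      using elim E(1) by (elim order_trans) (intro divide_left_mono power_mono mult_pos_pos, auto)
    then have "\<bar>\<beta> n * e (Suc n)\<bar> \<le> (B / real n ^ 2) * (E / real n ^ k)"
      unfolding abs_mult using elim B(1) by (intro mult_mono) auto
    also have "\<dots> = B * E / real n ^ (k + 2)"
      by (simp add: power_add power2_eq_square mult.commute)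
    finally have 1: "\<bar>\<beta> n * e (Suc n)\<bar> \<le> B * E / real n ^ (k + 2)" .
    have 2: "\<bar>- \<alpha> n * (e (Suc n) - e n)\<bar> \<le> 1 / 2 * \<bar>e (Suc n) - e n\<bar>"
      unfolding abs_mult using elim by (intro mult_right_mono) auto
    show ?case
      using 1 2 elim(4) unfolding elim(1) add_divide_distrib by linarith
  qed
  then show ?thesis
    by (rule halving_recursion_bigo)
qed

text \<open>
Bootstrapping: a bound \<open>1 / n^k\<close> on \<open>e\<close> gives \<open>1 / n^(k+2)\<close> on its differences, and summing these, as
\<open>e\<close> tends to \<open>0\<close>, gives \<open>1 / n^(k+1)\<close> on \<open>e\<close>. One power is gained in each round until the residual \<open>r\<close>
limits the gain.
\<close>

lemma null_solution_bigo:
  fixes e \<alpha> \<beta> r :: "nat \<Rightarrow> real"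
  assumes rec: "\<forall>\<^sub>F n in sequentially. e (Suc (Suc n)) - e (Suc n) = - \<alpha> n * (e (Suc n) - e n) + \<beta> n * e (Suc n) + r n"
    and \<alpha>: "\<forall>\<^sub>F n in sequentially. \<bar>\<alpha> n\<bar> \<le> 1 / 2"
    and \<beta>: "\<beta> \<in> O(\<lambda>n. 1 / real n ^ 2)"
    and r: "r \<in> O(\<lambda>n. 1 / real n ^ (K + 1))"
    and lim: "e \<longlonglongrightarrow> 0"
  shows "e \<in> O(\<lambda>n. 1 / real n ^ K)"
proof -
  have "e \<in> O(\<lambda>n. 1 / real n ^ k)" if "k \<le> K" for k
    using that
  proof (induction k)
    case 0
    have "e \<in> O(\<lambda>_. 1)"
      using lim by (intro bigoI_tendsto[of _ _ 0]) auto
    then show ?case by simp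
  next
    case (Suc k)
    have mono: "(\<lambda>n. 1 / real n ^ b) \<in> O(\<lambda>n. 1 / real n ^ a)" if "a \<le> b" for a b
    proof (rule bigo_inverse_powerI[of _ 1], rule eventually_mono[OF eventually_gt_at_top[of 0]])
      fix n :: nat assume "n > 0"
      then show "\<bar>1 / real n ^ b\<bar> \<le> 1 / real n ^ a"
        using that by (auto intro!: divide_left_mono power_increasing)
    qed
    have "r \<in> O(\<lambda>n. 1 / real n ^ (k + 2))"
      using Suc.prems by (intro landau_o.big_trans[OF r] mono) simp
    then have "(\<lambda>n. e (Suc n) - e n) \<in> O(\<lambda>n. 1 / real n ^ (k + 2))"
      using Suc by (intro difference_bigo[OF rec \<alpha> \<beta>]) auto
    then have "(\<lambda>n. e (Suc n) - e n) \<in> O(\<lambda>n. 1 / real n ^ (Suc k + 1))"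
      by (simp add: numeral_2_eq_2)
    then show ?case
      by (rule null_sequence_bigo[OF _ lim]) simp
  qed
  then show ?thesis by simp
qed

section \<open>The asymptotic expansion of the Franel numbers\<close>

text \<open>
With the factor \<open>n\<close>, the coefficients of the recurrence sum up to \<open>1 + O(1/n^2)\<close>, so that solutions converge.
\<close>

definition franel_scaled :: "nat \<Rightarrow> real" where
  "franel_scaled n = real n * franel n / 8 ^ n"

lemma franel_scaled_recurrence:
  assumes "n > 0"
  shows "franel_scaled (Suc (Suc n)) = (7 / 8 + 1 / (4 * (real n + 1) * (real n + 2))) * franel_scaled (Suc n)
      + (1 + 1 / (real n * (real n + 2))) / 8 * franel_scaled n"
proof -
  define x a b c p where defs: "x = real n" "a = franel n" "b = franel (Suc n)" "c = franel (Suc (Suc n))" "p = (8::real) ^ n"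
  have pos: "x > 0" "p > 0"
    using assms by (simp_all add: defs)
  have rec: "(x + 2) ^ 2 * c = (7 * x ^ 2 + 21 * x + 16) * b + 8 * (x + 1) ^ 2 * a"
    using franel_recurrence[of n] by (simp add: defs algebra_simps)
  have 1: "(7 / 8 + 1 / (4 * (x + 1) * (x + 2))) * ((x + 1) * b / (8 * p)) = (7 * x ^ 2 + 21 * x + 16) * b / (64 * p * (x + 2))"
    using pos by (simp add: divide_simps) algebra
  have 2: "(1 + 1 / (x * (x + 2))) / 8 * (x * a / p) = 8 * (x + 1) ^ 2 * a / (64 * p * (x + 2))"
    using pos by (simp add: divide_simps) algebra
  have "(x + 2) * c / (64 * p) = (x + 2) ^ 2 * c / (64 * p * (x + 2))"
    using pos by (simp add: power2_eq_square)
  also have "\<dots> = (7 * x ^ 2 + 21 * x + 16) * b / (64 * p * (x + 2)) + 8 * (x + 1) ^ 2 * a / (64 * p * (x + 2))"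
    unfolding rec add_divide_distrib ..
  finally have "(x + 2) * c / (64 * p) = (7 / 8 + 1 / (4 * (x + 1) * (x + 2))) * ((x + 1) * b / (8 * p)) + (1 + 1 / (x * (x + 2))) / 8 * (x * a / p)"
    unfolding 1 2 .
  then show ?thesis
    by (simp add: franel_scaled_def defs add.commute[of 1] add.commute[of 2])
qed

definition franel_alpha :: "nat \<Rightarrow> real" where
  "franel_alpha n = (1 + 1 / (real n * (real n + 2))) / 8"

definition franel_beta :: "nat \<Rightarrow> real" where
  "franel_beta n = 1 / (4 * (real n + 1) * (real n + 2)) + 1 / (8 * real n * (real n + 2))"

text \<open>
In terms of differences the characteristic root \<open>-1/8\<close> (that is, \<open>-1\<close> before division by \<open>8^n\<close>) becomes visible as the
limit of \<open>- franel_alpha\<close>.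
\<close>

lemma franel_scaled_difference:
  assumes "n > 0"
  shows "franel_scaled (Suc (Suc n)) - franel_scaled (Suc n)
     = - franel_alpha n * (franel_scaled (Suc n) - franel_scaled n) + franel_beta n * franel_scaled (Suc n)"
proof -
  have coeff: "7 / 8 + 1 / (4 * (real n + 1) * (real n + 2)) = 1 - franel_alpha n + franel_beta n"
    by (simp add: franel_alpha_def franel_beta_def add_divide_distrib)
  show ?thesis
    unfolding franel_scaled_recurrence[OF assms] franel_alpha_def[symmetric] coeff by (simp add: algebra_simps)
qed

lemma franel_alpha_bound: "\<forall>\<^sub>F n in sequentially. \<bar>franel_alpha n\<bar> \<le> 1 / 2"
  unfolding franel_alpha_def by real_asymp

lemma franel_beta_bigo: "franel_beta \<in> O(\<lambda>n. 1 / real n ^ 2)"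
  unfolding franel_beta_def[abs_def] by real_asymp

lemma franel_scaled_nonneg: "0 \<le> franel_scaled n"
  by (simp add: franel_scaled_def franel_def sum_nonneg)

text \<open>
The recurrence has nonnegative coefficients with sum \<open>1 + O(1/n^2)\<close>. The sequence \<open>2 - 1/n\<close> grows fast
enough to absorb this excess, so a multiple of it stays above the solution.
\<close>

lemma franel_scaled_bounded: "franel_scaled \<in> O(\<lambda>_. 1)"
proof -
  define M where "M = max (franel_scaled 3) (franel_scaled 4)"
  have M: "M \<ge> 0"
    by (simp add: M_def le_max_iff_disj franel_scaled_nonneg)
  have "franel_scaled n \<le> M * (2 - 1 / real n) \<and> franel_scaled (Suc n) \<le> M * (2 - 1 / real (Suc n))" if "n \<ge> 3" for n
    using that
  proof (induction n rule: dec_induct)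
    case base
    have "franel_scaled 3 \<le> M" "franel_scaled 4 \<le> M"
      by (simp_all add: M_def)
    moreover have "M * 1 \<le> M * (2 - 1 / 3)" "M * 1 \<le> M * (2 - 1 / 4)"
      using M by (intro mult_left_mono; simp)+
    ultimately show ?case
      by simp
  next
    case (step n)
    define x where "x = real n"
    have x: "x \<ge> 3"
      using step by (simp add: x_def)
    define a b where ab: "a = 7 / 8 + 1 / (4 * (x + 1) * (x + 2))" "b = (1 + 1 / (x * (x + 2))) / 8"
    have "a \<ge> 0" "b \<ge> 0"
      using x by (simp_all add: ab)
    have le: "2 - 1 / x \<le> 2 - 1 / (x + 1)"
      using frac_le[of 1 1 x "x + 1"] x by simp
    have "franel_scaled (Suc (Suc n)) = a * franel_scaled (Suc n) + b * franel_scaled n"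
      using franel_scaled_recurrence[of n] step by (simp add: ab x_def)
    also have "\<dots> \<le> a * (M * (2 - 1 / (x + 1))) + b * (M * (2 - 1 / (x + 1)))"
    proof (intro add_mono mult_left_mono)
      show "franel_scaled (Suc n) \<le> M * (2 - 1 / (x + 1))"
        using step by (simp add: x_def add.commute)
      have "franel_scaled n \<le> M * (2 - 1 / x)"
        using step by (simp add: x_def)
      also have "\<dots> \<le> M * (2 - 1 / (x + 1))"
        using le M by (intro mult_left_mono)
      finally show "franel_scaled n \<le> M * (2 - 1 / (x + 1))" .
    qed fact+
    also have "\<dots> = M * ((a + b) * (2 - 1 / (x + 1)))"
      by (simp only: distrib_left distrib_right mult_ac)
    also have "\<dots> \<le> M * (2 - 1 / (x + 2))"
    proof (intro mult_left_mono M)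
      have "a + b = 1 + (3 * x + 1) / (8 * x * (x + 1) * (x + 2))"
        using x by (simp add: ab divide_simps) algebra
      also have "\<dots> \<le> 1 + (4 * x) / (8 * x * (x + 1) * (x + 2))"
        using x by (intro add_left_mono divide_right_mono) auto
      also have "(4 * x) / (8 * x * (x + 1) * (x + 2)) = 1 / (2 * (x + 1) * (x + 2))"
        using x by simp
      finally have "(a + b) * (2 - 1 / (x + 1)) \<le> (1 + 1 / (2 * (x + 1) * (x + 2))) * (2 - 1 / (x + 1))"
        using x by (intro mult_right_mono) (auto simp: divide_simps)
      also have "\<dots> = 2 - 1 / (x + 2) - 1 / (2 * (x + 1) ^ 2 * (x + 2))"
        using x by (simp add: divide_simps) algebra
      also have "\<dots> \<le> 2 - 1 / (x + 2)"
        using x by simp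
      finally show "(a + b) * (2 - 1 / (x + 1)) \<le> 2 - 1 / (x + 2)" .
    qed
    finally have "franel_scaled (Suc (Suc n)) \<le> M * (2 - 1 / (x + 2))" .
    then show ?case
      using step by (simp add: x_def add.commute)
  qed
  note bound = this
  have "franel_scaled n \<le> 2 * M" if "n \<ge> 3" for n
  proof -
    have "franel_scaled n \<le> M * (2 - 1 / real n)"
      using bound that by blast
    also have "\<dots> \<le> M * 2"
      using M by (intro mult_left_mono) auto
    finally show ?thesis
      by simp
  qed
  then show ?thesis
    by (intro bigoI[of _ "2 * M"] eventually_sequentiallyI[of 3]) (simp add: franel_scaled_nonneg)
qed

lemma franel_scaled_limit: "franel_scaled \<longlonglongrightarrow> 2 / (sqrt 3 * pi)"
proof -
  have "(\<lambda>n. franel_scaled (Suc n) - franel_scaled n) \<in> O(\<lambda>n. 1 / real n ^ (0 + 2))"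
  proof (rule difference_bigo[OF _ franel_alpha_bound franel_beta_bigo, of franel_scaled "\<lambda>_. 0"])
    show "\<forall>\<^sub>F n in sequentially. franel_scaled (Suc (Suc n)) - franel_scaled (Suc n)
        = - franel_alpha n * (franel_scaled (Suc n) - franel_scaled n) + franel_beta n * franel_scaled (Suc n) + 0"
      using eventually_gt_at_top[of 0] by eventually_elim (simp add: franel_scaled_difference)
    show "franel_scaled \<in> O(\<lambda>n. 1 / real n ^ 0)"
      using franel_scaled_bounded by simp
  qed simp
  moreover have "summable (\<lambda>n. norm (1 / real n ^ (0 + 2)))"
    using inverse_power_summable[of 2, where ?'a = real] by (simp add: inverse_eq_divide power2_eq_square)
  ultimately have "summable (\<lambda>n. franel_scaled (Suc n) - franel_scaled n)"
    by (rule summable_comparison_test_bigo[rotated])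
  then obtain s where "(\<lambda>n. franel_scaled (Suc n) - franel_scaled n) sums s"
    by (auto simp: summable_def)
  then have "(\<lambda>n. franel_scaled n - franel_scaled 0) \<longlonglongrightarrow> s"
    by (simp only: sums_def sum_lessThan_telescope)
  moreover have "franel_scaled 0 = 0"
    by (simp add: franel_scaled_def)
  ultimately have L: "franel_scaled \<longlonglongrightarrow> s"
    by simp
  have "(\<lambda>m. franel_scaled (2 * m)) \<longlonglongrightarrow> s"
    using LIMSEQ_subseq_LIMSEQ[OF L, of "\<lambda>m. 2 * m"] by (simp add: strict_mono_def o_def)
  moreover have "(\<lambda>m. franel_scaled (2 * m)) \<longlonglongrightarrow> 2 / (sqrt 3 * pi)"
    using franel_even_limit by (simp add: franel_scaled_def)
  ultimately show ?thesis
    using L LIMSEQ_unique by blast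
qed

definition franel_series :: "real \<Rightarrow> real" where
  "franel_series x = 1 - x / 3 + x ^ 2 / 27 + x ^ 3 / 81 + x ^ 4 / 243 + 11 * x ^ 5 / 2187 + 49 * x ^ 6 / 19683"

text \<open>
The truncated series satisfies the recurrence of \<open>franel_scaled\<close> up to order \<open>n^(-8)\<close>. A term \<open>c x^7\<close> would
contribute at just this order, so the coefficients up to \<open>x^6\<close> are determined by it, given
the constant term \<open>1\<close>.
\<close>

lemma franel_series_residual:
  "(\<lambda>n. franel_alpha n * (franel_series (1 / real (Suc n)) - franel_series (1 / real n))
       - franel_beta n * franel_series (1 / real (Suc n))
       + (franel_series (1 / real (Suc (Suc n))) - franel_series (1 / real (Suc n)))) \<in> O(\<lambda>n. 1 / real n ^ 8)"
  unfolding franel_alpha_def franel_beta_def franel_series_def by real_asymp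

lemma franel_expansion:
  "(\<lambda>n. franel_scaled n - 2 / (sqrt 3 * pi) * franel_series (1 / real n)) \<in> O(\<lambda>n. 1 / real n ^ 7)"
proof -
  define L where "L = 2 / (sqrt 3 * pi)"
  define p r e :: "nat \<Rightarrow> real"
    where "p = (\<lambda>n. franel_series (1 / real n))"
      and "r = (\<lambda>n. franel_alpha n * (p (Suc n) - p n) - franel_beta n * p (Suc n) + (p (Suc (Suc n)) - p (Suc n)))"
      and "e = (\<lambda>n. franel_scaled n - L * p n)"
  have "e \<in> O(\<lambda>n. 1 / real n ^ 7)"
  proof (rule null_solution_bigo[OF _ franel_alpha_bound franel_beta_bigo, of e "\<lambda>n. - L * r n"])
    show "\<forall>\<^sub>F n in sequentially. e (Suc (Suc n)) - e (Suc n) = - franel_alpha n * (e (Suc n) - e n) + franel_beta n * e (Suc n) + - L * r n"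
      using eventually_gt_at_top[of 0]
    proof eventually_elim
      case (elim n)
      show ?case
        using franel_scaled_difference[OF elim] by (simp add: e_def r_def algebra_simps)
    qed
    have "r \<in> O(\<lambda>n. 1 / real n ^ 8)"
      using franel_series_residual by (simp only: r_def p_def)
    then show "(\<lambda>n. - L * r n) \<in> O(\<lambda>n. 1 / real n ^ (7 + 1))"
      by simp
    have "p \<longlonglongrightarrow> 1"
      unfolding p_def franel_series_def by real_asymp
    then have "e \<longlonglongrightarrow> L - L * 1"
      unfolding e_def L_def by (intro tendsto_intros franel_scaled_limit)
    then show "e \<longlonglongrightarrow> 0"
      by simp
  qed
  then show ?thesis
    by (simp add: e_def L_def p_def)
qed

section \<open>A maximum principle for a diagonally dominant recurrence\<close>

text \<open>
Let \<open>w\<close> be a positive supersolution that tends to infinity. As \<open>h\<close> is bounded, the quotient \<open>\<bar>h\<bar> / w\<close> tends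
to \<open>0\<close>, so if it exceeds \<open>M\<close> somewhere, it attains a maximum \<open>\<mu> > M\<close> at some index. This is not the initial
index \<open>N\<close>; at any other index \<open>\<bar>h\<bar> \<le> \<mu> w\<close> at the two neighbours contradicts the supersolution
inequality, whose reserve \<open>n/4 * w (n+1)\<close> absorbs the residual.
\<close>

lemma bounded_solution_bound:
  fixes h \<rho> :: "nat \<Rightarrow> real"
  assumes rec: "\<And>n. n \<ge> N \<Longrightarrow> (10 * real n + 15) * h (Suc n) = 8 * (real n + 2) * h (Suc (Suc n)) + 9 * (real n + 1) / 8 * h n - \<rho> n"
    and bounded: "\<And>n. n \<ge> N \<Longrightarrow> \<bar>h n\<bar> \<le> H"
    and \<rho>: "\<And>n. n \<ge> N \<Longrightarrow> \<bar>\<rho> n\<bar> \<le> R * (real n / 4 * w (Suc n))"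
    and w_growth: "filterlim w at_top sequentially"
    and w_pos: "\<And>n. n \<ge> N \<Longrightarrow> w n > 0"
    and super: "\<And>n. n \<ge> N \<Longrightarrow> 8 * (real n + 2) * w (Suc (Suc n)) + 9 * (real n + 1) / 8 * w n + real n / 4 * w (Suc n) \<le> (10 * real n + 15) * w (Suc n)"
    and M: "\<bar>h N\<bar> \<le> M * w N" "R \<le> M" "N > 0" "M > 0"
    and n: "n \<ge> N"
  shows "\<bar>h n\<bar> \<le> M * w n"
proof (rule ccontr)
  assume neg: "\<not> \<bar>h n\<bar> \<le> M * w n"
  define F where "F = {k. k \<ge> N \<and> \<bar>h k\<bar> > M * w k}"
  have "\<forall>\<^sub>F k in sequentially. w k > H / M"
    using w_growth by (simp add: filterlim_at_top_dense)
  then obtain K where K: "\<And>k. k \<ge> K \<Longrightarrow> w k > H / M"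
    unfolding eventually_sequentially by blast
  have "F \<subseteq> {..<K}"
  proof
    fix k assume k: "k \<in> F"
    show "k \<in> {..<K}"
    proof (rule ccontr)
      assume "k \<notin> {..<K}"
      then have "H < M * w k"
        using K[of k] M(4) by (simp add: pos_divide_less_eq mult.commute)
      then show False
        using k bounded[of k] by (simp add: F_def)
    qed
  qed
  then have fin: "finite F"
    using finite_subset by blast
  have "n \<in> F"
    using neg n by (simp add: F_def)
  define \<mu> where "\<mu> = Max ((\<lambda>k. \<bar>h k\<bar> / w k) ` F)"
  have "\<mu> \<in> (\<lambda>k. \<bar>h k\<bar> / w k) ` F"
    unfolding \<mu>_def using fin \<open>n \<in> F\<close> by (intro Max_in) auto
  then obtain k where k: "k \<in> F" "\<mu> = \<bar>h k\<bar> / w k"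
    by auto
  have wk: "w k > 0" "\<bar>h k\<bar> > M * w k" "k \<ge> N"
    using k(1) w_pos by (auto simp: F_def)
  have "\<mu> > M"
    using wk unfolding k(2) by (simp add: pos_less_divide_eq)
  have le: "\<bar>h j\<bar> \<le> \<mu> * w j" if "j \<ge> N" for j
  proof (cases "j \<in> F")
    case True
    then have "\<bar>h j\<bar> / w j \<le> \<mu>"
      unfolding \<mu>_def using fin by (intro Max_ge) auto
    then show ?thesis
      using w_pos[OF that] by (simp add: pos_divide_le_eq)
  next
    case False
    then have "\<bar>h j\<bar> \<le> M * w j"
      using that by (simp add: F_def)
    also have "\<dots> \<le> \<mu> * w j"
      using \<open>\<mu> > M\<close> w_pos[OF that] by (intro mult_right_mono) auto
    finally show ?thesis .
  qed
  have "k \<noteq> N"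
    using k(1) M(1) by (auto simp: F_def)
  then obtain m where m: "k = Suc m" "m \<ge> N"
    using wk(3) by (cases k) auto
  have hk: "\<bar>h (Suc m)\<bar> = \<mu> * w (Suc m)"
    using k(2) wk(1) by (simp add: m)
  have "(10 * real m + 15) * (\<mu> * w (Suc m)) = \<bar>(10 * real m + 15) * h (Suc m)\<bar>"
    by (simp add: abs_mult hk)
  also have "\<dots> \<le> \<bar>8 * (real m + 2) * h (Suc (Suc m))\<bar> + \<bar>9 * (real m + 1) / 8 * h m\<bar> + \<bar>\<rho> m\<bar>"
    unfolding rec[OF m(2)] by linarith
  also have "\<dots> \<le> 8 * (real m + 2) * (\<mu> * w (Suc (Suc m))) + 9 * (real m + 1) / 8 * (\<mu> * w m) + R * (real m / 4 * w (Suc m))"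
    using m(2) \<rho>[OF m(2)] le[of m] le[of "Suc (Suc m)"] by (intro add_mono) (auto simp: abs_mult intro!: mult_left_mono)
  also have "\<dots> = \<mu> * (8 * (real m + 2) * w (Suc (Suc m)) + 9 * (real m + 1) / 8 * w m + real m / 4 * w (Suc m)) - (\<mu> - R) * (real m / 4 * w (Suc m))"
  proof -
    have "A * (\<mu> * a) + B * (\<mu> * b) + R * X = \<mu> * (A * a + B * b + X) - (\<mu> - R) * X" for A B a b X
      by (simp add: algebra_simps)
    then show ?thesis .
  qed
  also have "\<dots> < \<mu> * ((10 * real m + 15) * w (Suc m))"
  proof -
    have "\<mu> * (8 * (real m + 2) * w (Suc (Suc m)) + 9 * (real m + 1) / 8 * w m + real m / 4 * w (Suc m)) \<le> \<mu> * ((10 * real m + 15) * w (Suc m))"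
      using super[OF m(2)] \<open>\<mu> > M\<close> M(4) by (intro mult_left_mono) auto
    moreover have "0 < (\<mu> - R) * (real m / 4 * w (Suc m))"
      using \<open>\<mu> > M\<close> M(2,3) m wk(1) by (intro mult_pos_pos) auto
    ultimately show ?thesis
      by linarith
  qed
  finally show False
    by (simp add: mult_ac)
qed

text \<open>
The supersolution is \<open>1 / n^(s+1) + \<epsilon> (21/20)^n\<close>. The second term makes it tend to infinity; the
bound obtained does not depend on \<open>\<epsilon>\<close>, which may tend to \<open>0\<close>. For large \<open>n\<close> consecutive values of
the first term have a ratio close to \<open>1\<close>, and \<open>8 + 9/8 < 10\<close>; for the second, \<open>8 t + 9/(8 t) < 10\<close> at \<open>t = 21/20\<close>.
\<close>

lemma bounded_solution_bigo:
  fixes h \<rho> :: "nat \<Rightarrow> real"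
  assumes rec: "\<forall>\<^sub>F n in sequentially. (10 * real n + 15) * h (Suc n) = 8 * (real n + 2) * h (Suc (Suc n)) + 9 * (real n + 1) / 8 * h n - \<rho> n"
    and bounded: "h \<in> O(\<lambda>_. 1)"
    and \<rho>: "\<rho> \<in> O(\<lambda>n. 1 / real n ^ s)"
  shows "h \<in> O(\<lambda>n. 1 / real n ^ Suc s)"
proof -
  define t :: real where "t = 21 / 20"
  define w where "w = (\<lambda>\<epsilon> n. 1 / real n ^ Suc s + \<epsilon> * t ^ n)"
  obtain H where H: "\<forall>\<^sub>F n in sequentially. \<bar>h n\<bar> \<le> H"
    using bounded by (elim landau_o.bigE) simp
  obtain R where R: "R > 0" "\<forall>\<^sub>F n in sequentially. \<bar>\<rho> n\<bar> \<le> R / real n ^ s"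
    using \<rho> by (rule bigo_inverse_powerE)
  have "(\<lambda>n. ((real n + 1) / real n) ^ Suc s) \<longlonglongrightarrow> 1 ^ Suc s"
    by (intro tendsto_power) real_asymp
  then have ratio: "\<forall>\<^sub>F n in sequentially. ((real n + 1) / real n) ^ Suc s < 11 / 10"
    by (rule order_tendstoD) simp
  have "\<forall>\<^sub>F n in sequentially. (10 * real n + 15) * h (Suc n) = 8 * (real n + 2) * h (Suc (Suc n)) + 9 * (real n + 1) / 8 * h n - \<rho> n
      \<and> \<bar>h n\<bar> \<le> H \<and> \<bar>\<rho> n\<bar> \<le> R / real n ^ s \<and> ((real n + 1) / real n) ^ Suc s < 11 / 10 \<and> n \<ge> 16"
    using rec H R(2) ratio eventually_ge_at_top[of 16] by eventually_elim simp
  then obtain N where N: "\<And>n. n \<ge> N \<Longrightarrow> (10 * real n + 15) * h (Suc n) = 8 * (real n + 2) * h (Suc (Suc n)) + 9 * (real n + 1) / 8 * h n - \<rho> n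
      \<and> \<bar>h n\<bar> \<le> H \<and> \<bar>\<rho> n\<bar> \<le> R / real n ^ s \<and> ((real n + 1) / real n) ^ Suc s < 11 / 10 \<and> n \<ge> 16"
    unfolding eventually_sequentially by blast
  \<comment> \<open>\<open>5 R\<close> suffices because \<open>R / n^s \<le> 11/10 R n / (n+1)^(s+1)\<close> and \<open>11/10 \<le> 5/4\<close>.\<close>
  define M where "M = max (\<bar>h N\<bar> * real N ^ Suc s) (5 * R)"
  have M: "M > 0"
    using R(1) by (simp add: M_def less_max_iff_disj)
  have v: "1 / real n ^ Suc s \<le> 11 / 10 * (1 / real (Suc n) ^ Suc s)" if "n \<ge> N" for n
  proof -
    have pos: "real n ^ Suc s > 0" "real (Suc n) ^ Suc s > 0"
      using N[OF that] by (auto intro!: zero_less_power)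
    have "real (Suc n) ^ Suc s / real n ^ Suc s < 11 / 10"
      using N[OF that] by (simp add: power_divide add.commute)
    then have "real (Suc n) ^ Suc s < 11 / 10 * real n ^ Suc s"
      using pos by (simp only: pos_divide_less_eq)
    then show ?thesis
      using pos by (simp add: pos_divide_le_eq pos_le_divide_eq)
  qed
  have bound: "\<bar>h n\<bar> \<le> M * w \<epsilon> n" if "\<epsilon> > 0" "n \<ge> N" for \<epsilon> n
  proof (rule bounded_solution_bound[where N = N and H = H and \<rho> = \<rho> and R = "5 * R"])
    show "filterlim (w \<epsilon>) at_top sequentially"
    proof (rule filterlim_at_top_mono)
      show "filterlim (\<lambda>n. \<epsilon> * t ^ n) at_top sequentially"
        unfolding t_def using that(1) by real_asymp
      show "\<forall>\<^sub>F n in sequentially. \<epsilon> * t ^ n \<le> w \<epsilon> n"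
        by (simp add: w_def)
    qed
    show "w \<epsilon> k > 0" for k
      using that(1) by (auto simp: w_def t_def intro!: add_nonneg_pos)
    show "\<bar>h N\<bar> \<le> M * w \<epsilon> N"
    proof -
      have "\<bar>h N\<bar> = \<bar>h N\<bar> * real N ^ Suc s * (1 / real N ^ Suc s)"
        using N[of N] by simp
      also have "\<dots> \<le> M * w \<epsilon> N"
        using M that(1) by (intro mult_mono) (auto simp: M_def w_def t_def)
      finally show ?thesis .
    qed
    show "\<bar>\<rho> k\<bar> \<le> 5 * R * (real k / 4 * w \<epsilon> (Suc k))" if k: "k \<ge> N" for k
    proof -
      have kpos: "real k > 0"
        using N[OF k] by simp
      have "R / real k ^ s = R * real k * (1 / real k ^ Suc s)"
        using kpos by simp
      also have "\<dots> \<le> R * real k * (11 / 10 * (1 / real (Suc k) ^ Suc s))"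
        using R(1) v[OF k] by (intro mult_left_mono) auto
      also have "\<dots> \<le> R * real k * (5 / 4 * w \<epsilon> (Suc k))"
      proof (intro mult_left_mono)
        have "0 \<le> 1 / real (Suc k) ^ Suc s" "0 \<le> \<epsilon> * t ^ Suc k"
          using \<open>\<epsilon> > 0\<close> by (auto simp: t_def)
        moreover have "11 / 10 * u \<le> 5 / 4 * (u + v)" if "0 \<le> u" "0 \<le> v" for u v :: real
        proof -
          have "5 / 4 * (u + v) = 11 / 10 * u + (3 / 20 * u + 5 / 4 * v)"
            by (simp add: field_simps)
          then show ?thesis
            using that by simp
        qed
        ultimately show "11 / 10 * (1 / real (Suc k) ^ Suc s) \<le> 5 / 4 * w \<epsilon> (Suc k)"
          unfolding w_def by blast
      qed (use R(1) in auto)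
      also have "\<dots> = 5 * R * (real k / 4 * w \<epsilon> (Suc k))"
        by simp
      finally have "R / real k ^ s \<le> 5 * R * (real k / 4 * w \<epsilon> (Suc k))" .
      moreover have "\<bar>\<rho> k\<bar> \<le> R / real k ^ s"
        using N[OF k] by blast
      ultimately show ?thesis
        by (rule order_trans[rotated])
    qed
    show "8 * (real k + 2) * w \<epsilon> (Suc (Suc k)) + 9 * (real k + 1) / 8 * w \<epsilon> k + real k / 4 * w \<epsilon> (Suc k) \<le> (10 * real k + 15) * w \<epsilon> (Suc k)" if k: "k \<ge> N" for k
    proof -
      define a b c where abc: "a = 1 / real k ^ Suc s" "b = 1 / real (Suc k) ^ Suc s" "c = 1 / real (Suc (Suc k)) ^ Suc s"
      have k16: "real k \<ge> 16"
        using N[OF k] by simp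
      have "c \<le> b" "b \<ge> 0"
        unfolding abc by (auto intro!: divide_left_mono power_mono simp del: power_Suc)
      have "8 * (real k + 2) * c + 9 * (real k + 1) / 8 * a + real k / 4 * b \<le> 8 * (real k + 2) * b + 9 * (real k + 1) / 8 * (11 / 10 * b) + real k / 4 * b"
        using v[OF k] \<open>c \<le> b\<close> by (intro add_mono mult_left_mono) (auto simp: abc)
      also have "\<dots> \<le> (10 * real k + 15) * b"
      proof -
        have "8 * (real k + 2) * b + 9 * (real k + 1) / 8 * (11 / 10 * b) + real k / 4 * b = (8 * (real k + 2) + 9 * (real k + 1) / 8 * (11 / 10) + real k / 4) * b"
          by (simp add: algebra_simps)
        also have "\<dots> \<le> (10 * real k + 15) * b"
          using k16 \<open>b \<ge> 0\<close> by (intro mult_right_mono) (auto simp: field_simps)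
        finally show ?thesis .
      qed
      finally have 1: "8 * (real k + 2) * c + 9 * (real k + 1) / 8 * a + real k / 4 * b \<le> (10 * real k + 15) * b" .
      have "8 * (real k + 2) * t ^ 2 + 9 * (real k + 1) / 8 + real k / 4 * t \<le> (10 * real k + 15) * t"
        using k16 by (simp add: t_def power2_eq_square field_simps)
      then have "(\<epsilon> * t ^ k) * (8 * (real k + 2) * t ^ 2 + 9 * (real k + 1) / 8 + real k / 4 * t) \<le> (\<epsilon> * t ^ k) * ((10 * real k + 15) * t)"
        using \<open>\<epsilon> > 0\<close> by (intro mult_left_mono) (auto simp: t_def)
      then have 2: "8 * (real k + 2) * (\<epsilon> * t ^ Suc (Suc k)) + 9 * (real k + 1) / 8 * (\<epsilon> * t ^ k) + real k / 4 * (\<epsilon> * t ^ Suc k) \<le> (10 * real k + 15) * (\<epsilon> * t ^ Suc k)"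
        by (simp add: power2_eq_square algebra_simps)
      show ?thesis
        using add_mono[OF 1 2] unfolding w_def abc[symmetric] by (simp only: distrib_left add_ac)
    qed
    show "N > 0" "5 * R \<le> M" "M > 0"
      using N[of N] M by (auto simp: M_def)
  qed (use N that in auto)
  have "\<bar>h n\<bar> \<le> M / real n ^ Suc s" if "n \<ge> N" for n
  proof (rule field_le_epsilon)
    fix \<delta> :: real assume "\<delta> > 0"
    \<comment> \<open>This \<open>\<epsilon>\<close> makes the exponential term contribute exactly \<open>\<delta>\<close> at the index \<open>n\<close>.\<close>
    then have "\<bar>h n\<bar> \<le> M * w (\<delta> / (M * t ^ n)) n"
      using M that by (intro bound) (auto simp: t_def)
    also have "\<dots> = M / real n ^ Suc s + \<delta>"
      using M by (simp add: w_def t_def distrib_left)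
    finally show "\<bar>h n\<bar> \<le> M / real n ^ Suc s + \<delta>" .
  qed
  then show ?thesis
    by (intro bigo_inverse_powerI eventually_sequentiallyI)
qed

section \<open>The asymptotic expansion of C3\<close>

definition C3_series :: "real \<Rightarrow> real" where
  "C3_series x = 1 - 13 / 3 * x + 1477 / 27 * x ^ 2 - 93707 / 81 * x ^ 3 + 8343061 / 243 * x ^ 4
     - 2866730137 / 2187 * x ^ 5 + 1204239422533 / 19683 * x ^ 6"

text \<open>
The two truncated series satisfy the recurrence of \<open>C3_recurrence\<close>, divided by \<open>8^(n+1)\<close>, up to order
\<open>n^(-7)\<close>. A further term of either series would enter at this order.
\<close>

lemma C3_series_residual:
  "(\<lambda>n. 8 * (real n + 2) * (C3_series (1 / real (Suc (Suc n))) / real (Suc (Suc n)))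
       - (10 * real n + 15) * (C3_series (1 / real (Suc n)) / real (Suc n))
       + 9 * (real n + 1) / 8 * (C3_series (1 / real n) / real n)
       + (real n + 1) * (3 / 8 * (franel_series (1 / real n) / real n) + franel_series (1 / real (Suc n)) / real (Suc n) / 2))
     \<in> O(\<lambda>n. 1 / real n ^ 7)"
  unfolding franel_series_def C3_series_def by real_asymp

text \<open>
The difference between \<open>C3 n / 8^n\<close> and its approximation is a bounded solution of the recurrence. Its
residual consists of the constant inhomogeneity, which becomes exponentially small, the error
of the Franel expansion and the residual of the series.
\<close>

lemma C3_expansion:
  "(\<lambda>n. real_of_int (C3 n) / 8 ^ n - 2 / (sqrt 3 * pi) * (C3_series (1 / real n) / real n)) \<in> O(\<lambda>n. 1 / real n ^ 8)"
proof -
  define L where "L = 2 / (sqrt 3 * pi)"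
  define q Q h where "q = (\<lambda>n. real_of_int (C3 n) / 8 ^ n)" and "Q = (\<lambda>n. C3_series (1 / real n) / real n)"
    and "h = (\<lambda>n. q n - L * Q n)"
  define f F d where "f = (\<lambda>n. franel n / 8 ^ n)" and "F = (\<lambda>n. franel_series (1 / real n) / real n)"
    and "d = (\<lambda>n. f n - L * F n)"
  define S where "S = (\<lambda>n. 8 * (real n + 2) * Q (Suc (Suc n)) - (10 * real n + 15) * Q (Suc n) + 9 * (real n + 1) / 8 * Q n
      + (real n + 1) * (3 / 8 * F n + F (Suc n) / 2))"
  define \<rho> where "\<rho> = (\<lambda>n. 1 / 8 ^ Suc n - (real n + 1) * (3 / 8 * d n + d (Suc n) / 2) - L * S n)"
  have "h \<in> O(\<lambda>n. 1 / real n ^ Suc 7)"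
  proof (rule bounded_solution_bigo)
    have rec: "8 * (real n + 2) * q (Suc (Suc n)) - (10 * real n + 15) * q (Suc n) + 9 * (real n + 1) / 8 * q n
        = 1 / 8 ^ Suc n - (real n + 1) * (3 / 8 * f n + f (Suc n) / 2)" for n
    proof -
      have "(real n + 2) * real_of_int (C3 (Suc (Suc n))) - (10 * real n + 15) * real_of_int (C3 (Suc n)) + 9 * (real n + 1) * real_of_int (C3 n)
          = 1 - (real n + 1) * (3 * franel n + franel (Suc n) / 2)"
        using C3_recurrence[of "Suc n"] by (simp add: algebra_simps)
      moreover have "8 * (real n + 2) * q (Suc (Suc n)) - (10 * real n + 15) * q (Suc n) + 9 * (real n + 1) / 8 * q n
          = ((real n + 2) * real_of_int (C3 (Suc (Suc n))) - (10 * real n + 15) * real_of_int (C3 (Suc n)) + 9 * (real n + 1) * real_of_int (C3 n)) / 8 ^ Suc n"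
      proof -
        have *: "8 * a * (c2 / (8 * (8 * p))) - b * (c1 / (8 * p)) + 9 * d / 8 * (c0 / p) = (a * c2 - b * c1 + 9 * d * c0) / (8 * p)"
          if "p > 0" for a b d c0 c1 c2 p :: real
          using that by (simp add: field_simps)
        show ?thesis
          unfolding q_def power_Suc by (rule *) simp
      qed
      moreover have "1 / 8 ^ Suc n - (real n + 1) * (3 / 8 * f n + f (Suc n) / 2) = (1 - (real n + 1) * (3 * franel n + franel (Suc n) / 2)) / 8 ^ Suc n"
      proof -
        have *: "1 / (8 * p) - x * (3 / 8 * (a / p) + b / (8 * p) / 2) = (1 - x * (3 * a + b / 2)) / (8 * p)"
          if "p > 0" for x a b p :: real
          using that by (simp add: field_simps)
        show ?thesis
          unfolding f_def power_Suc by (rule *) simp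
      qed
      ultimately show ?thesis
        by simp
    qed
    show "\<forall>\<^sub>F n in sequentially. (10 * real n + 15) * h (Suc n) = 8 * (real n + 2) * h (Suc (Suc n)) + 9 * (real n + 1) / 8 * h n - \<rho> n"
    proof (intro always_eventually allI)
      fix n
      have *: "a * (q1 - L * Q1) = b * (q2 - L * Q2) + c * (q0 - L * Q0)
          - (g - x * (3 / 8 * (f0 - L * F0) + (f1 - L * F1) / 2) - L * (b * Q2 - a * Q1 + c * Q0 + x * (3 / 8 * F0 + F1 / 2)))"
        if "b * q2 - a * q1 + c * q0 = g - x * (3 / 8 * f0 + f1 / 2)" for a b c x g q0 q1 q2 Q0 Q1 Q2 f0 f1 F0 F1 :: real
        using that by algebra
      show "(10 * real n + 15) * h (Suc n) = 8 * (real n + 2) * h (Suc (Suc n)) + 9 * (real n + 1) / 8 * h n - \<rho> n"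
        unfolding h_def \<rho>_def d_def S_def by (rule *[OF rec])
    qed
    have "q \<in> O(\<lambda>_. 1)"
    proof (rule bigoI[of _ 1], intro always_eventually allI)
      fix n
      have "real_of_int (C3 n) \<le> real_of_int (8 ^ n)" "0 \<le> real_of_int (C3 n)"
        using C3_bounds[of n] by (simp_all only: of_int_le_iff of_int_0_le_iff)
      then show "norm (q n) \<le> 1 * norm (1::real)"
        by (simp add: q_def)
    qed
    moreover have "Q \<in> O(\<lambda>_. 1)"
      unfolding Q_def C3_series_def by real_asymp
    ultimately show "h \<in> O(\<lambda>_. 1)"
      unfolding h_def by (intro sum_in_bigo) auto
    have d: "d \<in> O(\<lambda>n. 1 / real n ^ 8)"
    proof -
      have "(\<lambda>n. 1 / real n * (franel_scaled n - L * franel_series (1 / real n))) \<in> O(\<lambda>n. 1 / real n * (1 / real n ^ 7))"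
        unfolding L_def by (intro landau_o.big.mult franel_expansion) auto
      moreover have "\<forall>\<^sub>F n in sequentially. 1 / real n * (franel_scaled n - L * franel_series (1 / real n)) = d n"
        using eventually_gt_at_top[of 0]
        by eventually_elim (simp add: d_def f_def F_def franel_scaled_def diff_divide_distrib)
      ultimately show ?thesis
        by (subst (asm) landau_o.big.in_cong) (simp_all add: eval_nat_numeral)
    qed
    have "(\<lambda>n. d (Suc n)) \<in> O(\<lambda>n. 1 / real (Suc n) ^ 8)"
      using d by (rule landau_o.big.compose[OF _ filterlim_Suc])
    also have "(\<lambda>n. 1 / real (Suc n) ^ 8) \<in> O(\<lambda>n. 1 / real n ^ 8)"
      by real_asymp
    finally have "(\<lambda>n. 3 / 8 * d n + d (Suc n) / 2) \<in> O(\<lambda>n. 1 / real n ^ 8)"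
      using d by (intro sum_in_bigo) auto
    then have "(\<lambda>n. (real n + 1) * (3 / 8 * d n + d (Suc n) / 2)) \<in> O(\<lambda>n. (real n + 1) * (1 / real n ^ 8))"
      by (intro landau_o.big.mult) auto
    also have "(\<lambda>n. (real n + 1) * (1 / real n ^ 8)) \<in> O(\<lambda>n. 1 / real n ^ 7)"
      by real_asymp
    finally have 1: "(\<lambda>n. (real n + 1) * (3 / 8 * d n + d (Suc n) / 2)) \<in> O(\<lambda>n. 1 / real n ^ 7)" .
    have 2: "(\<lambda>n. 1 / 8 ^ Suc n) \<in> O(\<lambda>n. 1 / real n ^ 7)"
      by real_asymp
    have 3: "(\<lambda>n. L * S n) \<in> O(\<lambda>n. 1 / real n ^ 7)"
      using C3_series_residual by (simp add: S_def Q_def F_def)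
    show "\<rho> \<in> O(\<lambda>n. 1 / real n ^ 7)"
      unfolding \<rho>_def by (intro sum_in_bigo 1 2 3)
  qed
  then show ?thesis
    by (simp add: h_def q_def Q_def L_def)
qed

theorem proposition3:
  shows "\<exists>E :: nat \<Rightarrow> real. E \<in> O(\<lambda>n. 1 / real n ^ 7) \<and>
    (\<forall>n\<ge>1. real_of_int (C3 n) =
       2 / (sqrt 3 * pi) * 8 ^ n * (1 / real n) *
       (1 - 13 / 3 * (1 / real n)
          + 1477 / 27 * (1 / real n ^ 2)
          - 93707 / 81 * (1 / real n ^ 3)
          + 8343061 / 243 * (1 / real n ^ 4)
          - 2866730137 / 2187 * (1 / real n ^ 5)
          + 1204239422533 / 19683 * (1 / real n ^ 6)
          + E n))"
proof -
  define L where "L = 2 / (sqrt 3 * pi)"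
  have L: "L > 0"
    by (simp add: L_def)
  \<comment> \<open>Solving the claimed equation for the error term.\<close>
  define E where "E = (\<lambda>n. real n / L * (real_of_int (C3 n) / 8 ^ n - L * (C3_series (1 / real n) / real n)))"
  have "(\<lambda>n. real n / L * (real_of_int (C3 n) / 8 ^ n - L * (C3_series (1 / real n) / real n))) \<in> O(\<lambda>n. real n * (1 / real n ^ 8))"
    using L C3_expansion unfolding L_def by (intro landau_o.big.mult) auto
  also have "(\<lambda>n. real n * (1 / real n ^ 8)) \<in> O(\<lambda>n. 1 / real n ^ 7)"
    by real_asymp
  finally have "E \<in> O(\<lambda>n. 1 / real n ^ 7)"
    unfolding E_def .
  moreover have "real_of_int (C3 n) = L * 8 ^ n * (1 / real n) * (C3_series (1 / real n) + E n)" if "n \<ge> 1" for n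
    using that L by (simp add: E_def field_simps)
  ultimately show ?thesis
    unfolding L_def C3_series_def by (intro exI[of _ E]) (simp add: power_divide)
qed

end
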